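(* (1) $\operatorname{SI}_{\beta_2}(K_{2,2}^2)$ is minimally presented by $$k[x_1,x_2,\dots,x_6,x_2^\circ]/(x_2^2x_5+x_1^2x_6+x_3x_4-x_1x_2x_2^\circ).$$ Its graded character (multigraded Hilbert series) is equal to $$(1-\mathbf{z}^{\widetilde\sigma_3+\widetilde\sigma_4})(1-\mathbf{z}^{\widetilde\sigma_2^\circ})^{-1}\prod_{i=1}^6(1-\mathbf{z}^{\widetilde\sigma_i})^{-1}.$$ (2) $\operatorname{SI}_{\beta_2}(K_{2,2}^2)^U$ is minimally presented by $$k[w_1,w_2,x_1,x_3,x_4,x_5]/(w_1^2+4x_3x_4x_5-w_2x_1^2).$$ Its $\widetilde\sigma$-graded Hilbert series is equal to $$(1+\mathbf{z}^{\widetilde\sigma_2'})\left((1-\mathbf{z}^{\widetilde\sigma_1})(1-\mathbf{z}^{\widetilde\sigma_3})(1-\mathbf{z}^{\widetilde\sigma_4})(1-\mathbf{z}^{\widetilde\sigma_5})(1-\mathbf{z}^{2\widetilde\sigma_2^\circ})\right)^{-1}.$$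
   Context: $k$ is an algebraically closed field of characteristic zero. The quiver $K_{2,2}^2$ is $-1\xrightarrow{b_{-1}}-2\rightrightarrows2\xrightarrow{b_1}1$ with the two middle arrows $a_1,a_2$, and $\beta_2=(1,2,2,1)$ along $-1,-2,2,1$. A representation is a tuple of matrices $(B_{-1},A_1,A_2,B_1)$ with $B_{-1}$ of size $1\times2$, $A_1,A_2$ of size $2\times2$, $B_1$ of size $2\times1$ (row vector convention, paths act by products from left to right). $\operatorname{SI}_{\beta_2}(K_{2,2}^2)$ is the ring of polynomial functions on the space of such tuples invariant under base change by $\operatorname{SL}_{\beta_2}=\operatorname{SL}_1\times\operatorname{SL}_2\times\operatorname{SL}_2\times\operatorname{SL}_1$ (where $g$ replaces the matrix of an arrow $u\to v$ by $g_u^{-1}(\cdot)g_v$). It is graded by $\widetilde\sigma=(\sigma;\lambda)\in\mathbb{Z}^4\times\mathbb{Z}^2$: $\sigma$ (with unit vectors $\mathsf{e}_{-2},\mathsf{e}_{-1},\mathsf{e}_1,\mathsf{e}_2$) is the weight for $\operatorname{GL}_{\beta_2}$, $f(g\cdot M)=\prod_i\det(g_i)^{\sigma(i)}f(M)$, and $\lambda$ is the weight under $(t_1,t_2):(A_1,A_2)\mapsto(t_1A_1,t_2A_2)$. $U$ is the group of matrices $\begin{pmatrix}1&u\\ 0&1\end{pmatrix}$, acting on functions through $(A_1,A_2)\mapsto(A_1,A_2+uA_1)$. Notation: $x_1=\det(B_{-1}A_1B_1)$, $x_2=\det(B_{-1}A_2B_1)$, $x_3=\det(A_1B_1\,|\,A_2B_1)$,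 $x_4=\det\begin{pmatrix}B_{-1}A_1\\ B_{-1}A_2\end{pmatrix}$, $x_5=\det A_1$, $x_6=\det A_2$, $$x_2^\circ=\frac{x_2^2x_5+x_1^2x_6+x_3x_4}{x_1x_2},\qquad w_1=\frac{x_3x_4+x_1^2x_6}{x_2}-x_2x_5,\qquad w_2=(x_2^\circ)^2-4x_5x_6,$$ all of which are elements of $\operatorname{SI}_{\beta_2}(K_{2,2}^2)$. The degree of $x_i$ is $\widetilde\sigma_i$; explicitly $\widetilde\sigma_1=(\mathsf{e}_1-\mathsf{e}_{-1};1,0)$, $\widetilde\sigma_2=(\mathsf{e}_1-\mathsf{e}_{-1};0,1)$, $\widetilde\sigma_3=(2\mathsf{e}_1-\mathsf{e}_{-2};1,1)$, $\widetilde\sigma_4=(\mathsf{e}_2-2\mathsf{e}_{-1};1,1)$, $\widetilde\sigma_5=(\mathsf{e}_2-\mathsf{e}_{-2};2,0)$, $\widetilde\sigma_6=(\mathsf{e}_2-\mathsf{e}_{-2};0,2)$; moreover $\widetilde\sigma_2^\circ=\widetilde\sigma_6+\widetilde\sigma_1-\widetilde\sigma_2$ is the degree of $x_2^\circ$ and $\widetilde\sigma_2'=\widetilde\sigma_6+2\widetilde\sigma_1-\widetilde\sigma_2$ is the degree of $w_1$. "Minimally presented by $k[\dots]/(r)$" means that the listed elements form a minimal set of homogeneous algebra generators and that the ideal of relations among them is generated by the displayed relation $r$. *)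

theory Defs
  imports
    "HOL-Analysis.Analysis"
    "HOL-Computational_Algebra.Polynomial"
    "HOL-Library.Poly_Mapping"
    "HOL-Library.Function_Algebras"
begin

section \<open>Representations and base change\<close>

text \<open>\<open>Rep B A A' C\<close> is the tuple \<open>(B\<^sub>-\<^sub>1, A\<^sub>1, A\<^sub>2, B\<^sub>1)\<close>; \<open>'k^n^m\<close> is the type of
  \<open>m \<times> n\<close> matrices. A group element is \<open>GL g\<^sub>-\<^sub>2 g\<^sub>-\<^sub>1 g\<^sub>1 g\<^sub>2\<close>.\<close>

datatype 'k rep =
  Rep (Bm: "'k^2^1") (A1: "'k^2^2") (A2: "'k^2^2") (Bp: "'k^1^2")

datatype 'k gl =
  GL (g_m2: "'k^2^2") (g_m1: "'k^1^1") (g_p1: "'k^1^1") (g_p2: "'k^2^2")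

definition is_GL :: "'k::field gl \<Rightarrow> bool" where
  "is_GL g \<longleftrightarrow> invertible (g_m2 g) \<and> invertible (g_m1 g) \<and> invertible (g_p1 g) \<and> invertible (g_p2 g)"

definition is_SL :: "'k::field gl \<Rightarrow> bool" where
  "is_SL g \<longleftrightarrow> det (g_m2 g) = 1 \<and> det (g_m1 g) = 1 \<and> det (g_p1 g) = 1 \<and> det (g_p2 g) = 1"

definition base_change :: "'k::field gl \<Rightarrow> 'k rep \<Rightarrow> 'k rep" where
  "base_change g M = Rep
     (matrix_inv (g_m1 g) ** Bm M ** g_m2 g)
     (matrix_inv (g_m2 g) ** A1 M ** g_p2 g)
     (matrix_inv (g_m2 g) ** A2 M ** g_p2 g)
     (matrix_inv (g_p2 g) ** Bp M ** g_p1 g)"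

definition smult_mat :: "'k::field \<Rightarrow> 'k^'n^'m \<Rightarrow> 'k^'n^'m" where
  "smult_mat c A = (\<chi> i j. c * A $ i $ j)"

definition torus_act :: "'k::field \<Rightarrow> 'k \<Rightarrow> 'k rep \<Rightarrow> 'k rep" where
  "torus_act t1 t2 M = Rep (Bm M) (smult_mat t1 (A1 M)) (smult_mat t2 (A2 M)) (Bp M)"

definition U_act :: "'k::field \<Rightarrow> 'k rep \<Rightarrow> 'k rep" where
  "U_act u M = Rep (Bm M) (A1 M) (A2 M + smult_mat u (A1 M)) (Bp M)"


section \<open>Polynomial functions and semi-invariants\<close>

inductive_set alg_gen :: "('a \<Rightarrow> 'k::comm_ring_1) set \<Rightarrow> ('a \<Rightarrow> 'k) set"
  for X :: "('a \<Rightarrow> 'k) set" where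
  const: "(\<lambda>_. c) \<in> alg_gen X"
| gen: "f \<in> X \<Longrightarrow> f \<in> alg_gen X"
| add: "f \<in> alg_gen X \<Longrightarrow> g \<in> alg_gen X \<Longrightarrow> (\<lambda>M. f M + g M) \<in> alg_gen X"
| mult: "f \<in> alg_gen X \<Longrightarrow> g \<in> alg_gen X \<Longrightarrow> (\<lambda>M. f M * g M) \<in> alg_gen X"

definition coord_funs :: "('k::field rep \<Rightarrow> 'k) set" where
  "coord_funs =
     range (\<lambda>(i, j) M. Bm M $ i $ j) \<union> range (\<lambda>(i, j) M. A1 M $ i $ j) \<union>
     range (\<lambda>(i, j) M. A2 M $ i $ j) \<union> range (\<lambda>(i, j) M. Bp M $ i $ j)"

definition poly_funs :: "('k::field rep \<Rightarrow> 'k) set" where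
  "poly_funs = alg_gen coord_funs"

definition SI :: "('k::field rep \<Rightarrow> 'k) set" where
  "SI = {f \<in> poly_funs. \<forall>g M. is_SL g \<longrightarrow> f (base_change g M) = f M}"

definition SI_U :: "('k::field rep \<Rightarrow> 'k) set" where
  "SI_U = {f \<in> SI. \<forall>u M. f (U_act u M) = f M}"

text \<open>Degrees \<open>((\<sigma>(-2), \<sigma>(-1), \<sigma>(1), \<sigma>(2)), (\<lambda>\<^sub>1, \<lambda>\<^sub>2))\<close>, added componentwise.\<close>

type_synonym wt = "(int \<times> int \<times> int \<times> int) \<times> (int \<times> int)"

fun has_weight :: "wt \<Rightarrow> ('k::field rep \<Rightarrow> 'k) \<Rightarrow> bool" where
  "has_weight ((s_m2, s_m1, s_p1, s_p2), (l1, l2)) f \<longleftrightarrow>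
     (\<forall>g M. is_GL g \<longrightarrow> f (base_change g M) =
        det (g_m2 g) powi s_m2 * det (g_m1 g) powi s_m1 *
        det (g_p1 g) powi s_p1 * det (g_p2 g) powi s_p2 * f M) \<and>
     (\<forall>t1 t2 M. t1 \<noteq> 0 \<longrightarrow> t2 \<noteq> 0 \<longrightarrow>
        f (torus_act t1 t2 M) = t1 powi l1 * t2 powi l2 * f M)"

definition component :: "('k::field rep \<Rightarrow> 'k) set \<Rightarrow> wt \<Rightarrow> ('k rep \<Rightarrow> 'k) set" where
  "component R d = {f \<in> R. has_weight d f}"


section \<open>The distinguished elements\<close>

definition x1 :: "'k::field rep \<Rightarrow> 'k" where
  "x1 M = det (Bm M ** A1 M ** Bp M)"

definition x2 :: "'k::field rep \<Rightarrow> 'k" where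
  "x2 M = det (Bm M ** A2 M ** Bp M)"

definition x3 :: "'k::field rep \<Rightarrow> 'k" where
  "x3 M = det (\<chi> (i::2) (j::2). if j = 1 then (A1 M ** Bp M) $ i $ 1 else (A2 M ** Bp M) $ i $ 1)"

definition x4 :: "'k::field rep \<Rightarrow> 'k" where
  "x4 M = det (\<chi> (i::2) (j::2). if i = 1 then (Bm M ** A1 M) $ 1 $ j else (Bm M ** A2 M) $ 1 $ j)"

definition x5 :: "'k::field rep \<Rightarrow> 'k" where
  "x5 M = det (A1 M)"

definition x6 :: "'k::field rep \<Rightarrow> 'k" where
  "x6 M = det (A2 M)"

text \<open>The quotient of two polynomial functions, as elements of the fraction field of the ring of
  polynomial functions, when it lies in that ring. Pointwise division would be
  wrong at the zeros of the denominator.\<close>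

definition quot :: "('k::field rep \<Rightarrow> 'k) \<Rightarrow> ('k rep \<Rightarrow> 'k) \<Rightarrow> ('k rep \<Rightarrow> 'k)" where
  "quot f g = (THE h. h \<in> poly_funs \<and> (\<forall>M. h M * g M = f M))"

text \<open>The polynomial functions form an integral domain (restrict to the line through two
  representations), so such a quotient is unique if it exists.\<close>

definition segment_rep :: "'k::field rep \<Rightarrow> 'k rep \<Rightarrow> 'k \<Rightarrow> 'k rep" where
  "segment_rep M N t = Rep (Bm M + smult_mat t (Bm N - Bm M)) (A1 M + smult_mat t (A1 N - A1 M))
     (A2 M + smult_mat t (A2 N - A2 M)) (Bp M + smult_mat t (Bp N - Bp M))"

lemma affine_poly: "\<exists>p::'k::field poly. \<forall>t. a + t * (b - a) = poly p t"
  by (rule exI[of _ "[:a, b - a:]"]) simp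

lemma poly_on_segment:
  assumes "f \<in> poly_funs"
  shows "\<exists>p::'k::field poly. \<forall>t. f (segment_rep M N t) = poly p t"
  using assms unfolding poly_funs_def
proof induction
  case (const c) show ?case by (rule exI[of _ "[:c:]"]) simp
next
  case (gen f) then show ?case
    unfolding coord_funs_def by (auto simp: segment_rep_def smult_mat_def intro!: affine_poly)
next
  case (add f g)
  then obtain p q where "\<forall>t. f (segment_rep M N t) = poly p t" "\<forall>t. g (segment_rep M N t) = poly q t" by blast
  then show ?case by (intro exI[of _ "p + q"]) simp
next
  case (mult f g)
  then obtain p q where "\<forall>t. f (segment_rep M N t) = poly p t" "\<forall>t. g (segment_rep M N t) = poly q t" by blast
  then show ?case by (intro exI[of _ "p * q"]) simp
qed

lemma segment_rep_0: "segment_rep M N 0 = M" and segment_rep_1: "segment_rep M N 1 = N"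
  by (auto simp: segment_rep_def smult_mat_def vec_eq_iff intro!: rep.expand)

lemma poly_funs_domain:
  fixes f g :: "'k::field_char_0 rep \<Rightarrow> 'k"
  assumes "f \<in> poly_funs" "g \<in> poly_funs" "\<And>M. f M * g M = 0" "g N \<noteq> 0"
  shows "f M = 0"
proof -
  obtain p q where p: "\<forall>t. f (segment_rep M N t) = poly p t" and q: "\<forall>t. g (segment_rep M N t) = poly q t"
    using poly_on_segment assms(1,2) by metis
  have "poly (p * q) t = 0" for t using assms(3)[of "segment_rep M N t"] p q by simp
  then have "p * q = 0" using poly_all_0_iff_0 by blast
  moreover have "q \<noteq> 0" using q assms(4) segment_rep_1 by (metis poly_0)
  ultimately have "p = 0" by simp
  then show ?thesis using p segment_rep_0 by (metis poly_0)
qed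

lemma quot_eqI:
  fixes f g :: "'k::field_char_0 rep \<Rightarrow> 'k"
  assumes h: "h \<in> poly_funs" "\<And>M. h M * g M = f M" and g: "g \<in> poly_funs" "g N \<noteq> 0"
  shows "quot f g = h"
  unfolding quot_def
proof (rule the_equality)
  fix h' assume h': "h' \<in> poly_funs \<and> (\<forall>M. h' M * g M = f M)"
  have "(\<lambda>M. h' M + (\<lambda>_. -1) M * h M) \<in> poly_funs"
    using h' h(1) unfolding poly_funs_def by (intro alg_gen.add alg_gen.mult alg_gen.const) auto
  moreover have "(h' M + (- 1) * h M) * g M = 0" for M
    using h' h(2)[of M] by (simp add: left_diff_distrib)
  ultimately have "h' M + (- 1) * h M = 0" for M
    using poly_funs_domain[of "\<lambda>M. h' M + (- 1) * h M" g] g by blast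
  then show "h' = h" by (simp add: fun_eq_iff)
qed (use h in auto)

definition x2o :: "'k::field rep \<Rightarrow> 'k" where
  "x2o = quot (\<lambda>M. (x2 M)\<^sup>2 * x5 M + (x1 M)\<^sup>2 * x6 M + x3 M * x4 M) (\<lambda>M. x1 M * x2 M)"

definition w1 :: "'k::field rep \<Rightarrow> 'k" where
  "w1 M = quot (\<lambda>M. x3 M * x4 M + (x1 M)\<^sup>2 * x6 M) x2 M - x2 M * x5 M"

definition w2 :: "'k::field rep \<Rightarrow> 'k" where
  "w2 M = (x2o M)\<^sup>2 - 4 * x5 M * x6 M"

definition d1 :: wt where "d1 = ((0, -1, 1, 0), (1, 0))"
definition d2 :: wt where "d2 = ((0, -1, 1, 0), (0, 1))"
definition d3 :: wt where "d3 = ((-1, 0, 2, 0), (1, 1))"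
definition d4 :: wt where "d4 = ((0, -2, 0, 1), (1, 1))"
definition d5 :: wt where "d5 = ((-1, 0, 0, 1), (2, 0))"
definition d6 :: wt where "d6 = ((-1, 0, 0, 1), (0, 2))"
definition d2o :: wt where "d2o = d6 + d1 - d2"
definition d2' :: wt where "d2' = d6 + (d1 + d1) - d2"

datatype var = X1 | X2 | X3 | X4 | X5 | X6 | X2o | W1 | W2

primrec elem :: "var \<Rightarrow> 'k::field rep \<Rightarrow> 'k" where
  "elem X1 = x1" | "elem X2 = x2" | "elem X3 = x3" | "elem X4 = x4" | "elem X5 = x5"
| "elem X6 = x6" | "elem X2o = x2o" | "elem W1 = w1" | "elem W2 = w2"

primrec vdeg :: "var \<Rightarrow> wt" where
  "vdeg X1 = d1" | "vdeg X2 = d2" | "vdeg X3 = d3" | "vdeg X4 = d4" | "vdeg X5 = d5"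
| "vdeg X6 = d6" | "vdeg X2o = d2o" | "vdeg W1 = d2'" | "vdeg W2 = d2o + d2o"


section \<open>Presentations\<close>

text \<open>\<open>('v \<Rightarrow>\<^sub>0 nat) \<Rightarrow>\<^sub>0 'k\<close>, with the convolution product of the library, is the polynomial ring in
  the variables \<open>'v\<close>; \<open>poly_ring V\<close> is its subring \<open>k[V]\<close>.\<close>

type_synonym ('v, 'k) mpol = "('v \<Rightarrow>\<^sub>0 nat) \<Rightarrow>\<^sub>0 'k"

definition Var :: "'v \<Rightarrow> ('v, 'k::comm_ring_1) mpol" where
  "Var v = Poly_Mapping.single (Poly_Mapping.single v 1) 1"

definition poly_ring :: "'v set \<Rightarrow> ('v, 'k::comm_ring_1) mpol set" where
  "poly_ring V = {p. \<forall>m \<in> Poly_Mapping.keys p. Poly_Mapping.keys m \<subseteq> V}"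

definition poly_eval :: "('v \<Rightarrow> 'k) \<Rightarrow> ('v, 'k::comm_ring_1) mpol \<Rightarrow> 'k" where
  "poly_eval a p = (\<Sum>m \<in> Poly_Mapping.keys p.
     Poly_Mapping.lookup p m * (\<Prod>v \<in> Poly_Mapping.keys m. a v ^ Poly_Mapping.lookup m v))"

definition relations :: "('v \<Rightarrow> 'a \<Rightarrow> 'k::comm_ring_1) \<Rightarrow> 'v set \<Rightarrow> ('v, 'k) mpol set" where
  "relations x V = {p \<in> poly_ring V. \<forall>M. poly_eval (\<lambda>v. x v M) p = 0}"

definition minimally_presented ::
  "('k::field rep \<Rightarrow> 'k) set \<Rightarrow> var set \<Rightarrow> (var, 'k) mpol \<Rightarrow> bool" where
  "minimally_presented R V r \<longleftrightarrow>
     (\<forall>v\<in>V. elem v \<in> component R (vdeg v)) \<and>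
     alg_gen (elem ` V) = R \<and>
     (\<forall>v\<in>V. alg_gen (elem ` (V - {v})) \<noteq> R) \<and>
     relations elem V = {q * r | q. q \<in> poly_ring V}"


section \<open>Multigraded Hilbert series\<close>

text \<open>A series \<open>\<Sum>\<^sub>d c\<^sub>d z\<^sup>d\<close> is the function \<open>d \<mapsto> c\<^sub>d\<close>. In \<open>f \<star> g\<close> the coefficient sum is meaningful
  only if it has finitely many nonzero terms. This holds for all series used here: they are
  supported in a finitely generated cone whose nonzero elements have \<open>\<lambda>\<^sub>1 + \<lambda>\<^sub>2 > 0\<close>.\<close>

type_synonym 'd series = "'d \<Rightarrow> int"

definition zpow :: "'d \<Rightarrow> 'd series" where
  "zpow s = (\<lambda>d. if d = s then 1 else 0)"

definition series_mult :: "'d::ab_group_add series \<Rightarrow> 'd series \<Rightarrow> 'd series"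
    (infixl \<open>\<star>\<close> 70) where
  "f \<star> g = (\<lambda>d. \<Sum>a | f a \<noteq> 0 \<and> g (d - a) \<noteq> 0. f a * g (d - a))"

text \<open>\<open>geom s = 1 + z\<^sup>s + z\<^sup>2\<^sup>s + \<dots>\<close> is the expansion of \<open>(1 - z\<^sup>s)\<^sup>-\<^sup>1\<close>.\<close>

definition geom :: "'d::ab_group_add \<Rightarrow> 'd series" where
  "geom s = (\<lambda>d. if \<exists>n. d = (((+) s) ^^ n) 0 then 1 else 0)"

lemma geom_inverse:
  fixes s :: "'d::ab_group_add"
  assumes "\<And>n. n > 0 \<Longrightarrow> (((+) s) ^^ n) 0 \<noteq> 0"
  shows "(zpow 0 - zpow s) \<star> geom s = zpow 0"
proof
  fix d
  have s: "s \<noteq> 0" using assms[of 1] by simp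
  let ?f = "zpow 0 - zpow s"
  have "(?f \<star> geom s) d = (\<Sum>a\<in>{0, s}. ?f a * geom s (d - a))"
    unfolding series_mult_def
    by (rule sum.mono_neutral_left) (auto simp: zpow_def split: if_splits)
  also have "\<dots> = geom s d - geom s (d - s)"
    using s by (simp add: zpow_def)
  also have "\<dots> = zpow 0 d"
  proof -
    have 1: "(\<exists>n. d = (((+) s) ^^ n) 0) \<longleftrightarrow> d = 0 \<or> (\<exists>n. d = (((+) s) ^^ Suc n) 0)"
      by (metis funpow_0 not0_implies_Suc)
    have 2: "(\<exists>n. d - s = (((+) s) ^^ n) 0) \<longleftrightarrow> (\<exists>n. d = (((+) s) ^^ Suc n) 0)"
      by (simp add: algebra_simps)
    have 3: "d = 0 \<Longrightarrow> \<not> (\<exists>n. d = (((+) s) ^^ Suc n) 0)"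
      using assms[OF zero_less_Suc] by metis
    show ?thesis unfolding geom_def zpow_def 1 2 using 3 by auto
  qed
  finally show "(?f \<star> geom s) d = zpow 0 d" .
qed

definition scale_fun :: "'k::field \<Rightarrow> ('a \<Rightarrow> 'k) \<Rightarrow> 'a \<Rightarrow> 'k" where
  "scale_fun c f = (\<lambda>M. c * f M)"

lemma vector_space_scale_fun: "vector_space (scale_fun :: 'k::field \<Rightarrow> ('a \<Rightarrow> 'k) \<Rightarrow> 'a \<Rightarrow> 'k)"
  by unfold_locales (auto simp: scale_fun_def fun_eq_iff algebra_simps)

text \<open>The library's \<open>dim\<close> is \<open>0\<close> on infinite-dimensional spaces, so finite dimension of the
  components is required separately.\<close>

definition has_hilbert_series :: "('k::field rep \<Rightarrow> 'k) set \<Rightarrow> wt series \<Rightarrow> bool" where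
  "has_hilbert_series R H \<longleftrightarrow>
     (\<forall>d. (\<exists>B. finite B \<and> component R d \<subseteq> module.span scale_fun B) \<and>
          int (vector_space.dim scale_fun (component R d)) = H d)"

end

theory Submission
  imports Defs
begin

text \<open>With \<open>D\<close> the polarized determinant of \<open>(A\<^sub>1, A\<^sub>2)\<close>, one has \<open>x\<^sub>2\<^sup>o = D\<close> and
  \<open>w\<^sub>1 = x\<^sub>1 D - 2 x\<^sub>2 x\<^sub>5\<close>. Where \<open>x\<^sub>1\<close> does not vanish, every representation can be moved by
  \<open>SL\<close> to a normal form whose entries are Laurent polynomials in \<open>x\<^sub>1, \<dots>, x\<^sub>5, D\<close> (and by \<open>SL\<close> and
  \<open>U\<close> to one with \<open>x\<^sub>2 = 0\<close>, with entries in \<open>x\<^sub>1, x\<^sub>3, x\<^sub>4, x\<^sub>5, w\<^sub>1\<close>), so every invariant \<open>f\<close>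
  satisfies \<open>x\<^sub>1\<^sup>N f \<in> R\<close> for the proposed ring \<open>R\<close>. To cancel \<open>x\<^sub>1\<close>, reduce modulo the relation to
  monomials not divisible by \<open>x\<^sub>3 x\<^sub>4\<close> (respectively \<open>w\<^sub>1\<^sup>2\<close>). On the divisor \<open>x\<^sub>1 = 0\<close> these become
  distinct Laurent monomials on a torus, hence are independent, so a combination vanishing there is
  divisible by \<open>x\<^sub>1\<close>. Independence also yields the ideal of relations and, by counting normal
  monomials of each weight, the Hilbert series.\<close>

text \<open>Inverting \<open>x1\<close> loses information: the relations then express
  \<open>x6\<close>, respectively \<open>w2\<close>, through the other generators, so the normal
  forms never use them. They become indispensable when \<open>x1\<close> is cancelled again, and
  this cancellation is the real obstacle. The leading monomials are chosen for it. They avoid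
  \<open>x1\<close>, and one of their variables is absent from the rest of the relation, so
  rewriting terminates. On x1 = 0 the relation becomes a binomial equation, x3 x4 = - x2^2 x5
  respectively w1^2 = - 4 x3 x4 x5, which can be solved for x4 where the other variables are
  nonzero; this is where the torus comes from. Both relations come from the quadratic form q(s, t) =
  det(s A1 + t A2) = x5 s^2 + D s t + x6 t^2: its value at (x2, - x1) is - x3 x4, its discriminant
  is \<open>w2\<close>, and its derivative in s at that point is - w1.\<close>

abbreviation (input) "lookup \<equiv> Poly_Mapping.lookup"
abbreviation (input) "keys \<equiv> Poly_Mapping.keys"
abbreviation (input) "single \<equiv> Poly_Mapping.single"

section \<open>Polynomial rings and evaluation\<close>

definition monom_eval :: "('v \<Rightarrow> 'k) \<Rightarrow> ('v \<Rightarrow>\<^sub>0 nat) \<Rightarrow> 'k::comm_ring_1" where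
  "monom_eval a m = (\<Prod>v\<in>keys m. a v ^ lookup m v)"

lemma monom_eval_superset:
  assumes "finite V" "keys m \<subseteq> V"
  shows "monom_eval a m = (\<Prod>v\<in>V. a v ^ lookup m v)"
  unfolding monom_eval_def
  by (rule prod.mono_neutral_left) (use assms in \<open>auto simp: in_keys_iff\<close>)

lemma monom_eval_add: "monom_eval a (m + n) = monom_eval a m * monom_eval a n"
proof -
  let ?V = "keys m \<union> keys n"
  have "monom_eval a l = (\<Prod>v\<in>?V. a v ^ lookup l v)" if "keys l \<subseteq> ?V" for l
    by (rule monom_eval_superset) (use that in auto)
  then show ?thesis
    using keys_add[of m n] by (simp add: lookup_add power_add prod.distrib)
qed

lemma monom_eval_0 [simp]: "monom_eval a 0 = 1"
  by (simp add: monom_eval_def)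

lemma monom_eval_single [simp]: "monom_eval a (single v n) = a v ^ n"
  by (simp add: monom_eval_def)

lemma poly_eval_superset:
  assumes "finite S" "keys p \<subseteq> S"
  shows "poly_eval a p = (\<Sum>m\<in>S. lookup p m * monom_eval a m)"
  unfolding poly_eval_def monom_eval_def
  by (rule sum.mono_neutral_left) (use assms in \<open>auto simp: in_keys_iff\<close>)

lemma poly_eval_eq_sum_keys: "poly_eval a p = (\<Sum>m\<in>keys p. lookup p m * monom_eval a m)"
  by (rule poly_eval_superset) auto

lemma poly_eval_0 [simp]: "poly_eval a 0 = 0"
  by (simp add: poly_eval_def)

lemma poly_eval_single [simp]: "poly_eval a (single m c) = c * monom_eval a m"
  by (simp add: poly_eval_eq_sum_keys)

lemma poly_eval_1 [simp]: "poly_eval a 1 = 1"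
  by (simp add: poly_eval_eq_sum_keys)

lemma poly_eval_Var [simp]: "poly_eval a (Var v) = a v"
  by (simp add: Var_def)

lemma poly_eval_add [simp]: "poly_eval a (p + q) = poly_eval a p + poly_eval a q"
proof -
  let ?S = "keys p \<union> keys q"
  have "poly_eval a r = (\<Sum>m\<in>?S. lookup r m * monom_eval a m)" if "keys r \<subseteq> ?S" for r
    by (rule poly_eval_superset) (use that in auto)
  then show ?thesis
    using keys_add[of p q] by (simp add: lookup_add distrib_right sum.distrib)
qed

lemma poly_eval_uminus [simp]: "poly_eval a (- p) = - poly_eval a p"
  using poly_eval_add[of a p "- p"] by (simp add: eq_neg_iff_add_eq_0 add.commute)

lemma poly_eval_diff [simp]: "poly_eval a (p - q) = poly_eval a p - poly_eval a q"
  using poly_eval_add[of a p "- q"] by simp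

lemma poly_eval_sum: "poly_eval a (sum f S) = (\<Sum>i\<in>S. poly_eval a (f i))"
  by (induction S rule: infinite_finite_induct) auto

lemma mpol_sum_single: "p = (\<Sum>m\<in>keys p. single m (lookup p m))"
proof (rule poly_mapping_eqI)
  fix k
  show "lookup p k = lookup (\<Sum>m\<in>keys p. single m (lookup p m)) k"
    by (simp add: lookup_sum lookup_single when_def in_keys_iff)
qed

lemma poly_eval_mult [simp]: "poly_eval a (p * q) = poly_eval a p * poly_eval a q"
proof -
  have "p * q = (\<Sum>m\<in>keys p. \<Sum>n\<in>keys q. single (m + n) (lookup p m * lookup q n))"
    by (subst mpol_sum_single[of p], subst mpol_sum_single[of q])
      (simp add: sum_product mult_single)
  then show ?thesis
    by (simp add: poly_eval_sum poly_eval_eq_sum_keys[of a p] poly_eval_eq_sum_keys[of a q]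
        sum_product monom_eval_add mult_ac)
qed

lemma poly_eval_power [simp]: "poly_eval a (p ^ n) = poly_eval a p ^ n"
  by (induction n) auto

lemma poly_eval_numeral [simp]: "poly_eval a (numeral n) = numeral n"
  by (subst single_numeral[symmetric], subst poly_eval_single) simp

lemma poly_ring_0 [simp]: "0 \<in> poly_ring V"
  and poly_ring_1 [simp]: "1 \<in> poly_ring V"
  and poly_ring_single: "keys m \<subseteq> V \<Longrightarrow> single m c \<in> poly_ring V"
  and poly_ring_Var: "v \<in> V \<Longrightarrow> Var v \<in> poly_ring V"
  by (auto simp: poly_ring_def Var_def)

lemma poly_ring_add: "p \<in> poly_ring V \<Longrightarrow> q \<in> poly_ring V \<Longrightarrow> p + q \<in> poly_ring V"
  using keys_add[of p q] by (fastforce simp: poly_ring_def)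

lemma poly_ring_uminus: "p \<in> poly_ring V \<Longrightarrow> - p \<in> poly_ring V"
  by (auto simp: poly_ring_def in_keys_iff)

lemma poly_ring_diff: "p \<in> poly_ring V \<Longrightarrow> q \<in> poly_ring V \<Longrightarrow> p - q \<in> poly_ring V"
  using poly_ring_add[of p V "- q"] poly_ring_uminus[of q V] by simp

lemma poly_ring_mult:
  assumes "p \<in> poly_ring V" "q \<in> poly_ring V"
  shows "p * q \<in> poly_ring V"
  unfolding poly_ring_def
proof (intro CollectI ballI)
  fix m assume "m \<in> keys (p * q)"
  then obtain a b where "m = a + b" "a \<in> keys p" "b \<in> keys q"
    using keys_mult[of p q] by blast
  then show "keys m \<subseteq> V"
    using assms keys_add[of a b] unfolding poly_ring_def by blast
qed

lemma poly_ring_power: "p \<in> poly_ring V \<Longrightarrow> p ^ n \<in> poly_ring V"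
  by (induction n) (auto intro: poly_ring_mult)

lemma poly_ring_numeral [simp]: "numeral n \<in> poly_ring V"
  by (subst single_numeral[symmetric], rule poly_ring_single) simp

section \<open>Generated algebras and their polynomial representatives\<close>

lemma alg_gen_power: "f \<in> alg_gen X \<Longrightarrow> (\<lambda>M. f M ^ n) \<in> alg_gen X"
  by (induction n) (auto intro: alg_gen.const alg_gen.mult)

lemma alg_gen_prod: "(\<And>i. i \<in> S \<Longrightarrow> f i \<in> alg_gen X) \<Longrightarrow> (\<lambda>M. \<Prod>i\<in>S. f i M) \<in> alg_gen X"
  by (induction S rule: infinite_finite_induct) (auto intro: alg_gen.const alg_gen.mult)

lemma alg_gen_sum: "(\<And>i. i \<in> S \<Longrightarrow> f i \<in> alg_gen X) \<Longrightarrow> (\<lambda>M. \<Sum>i\<in>S. f i M) \<in> alg_gen X"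
  by (induction S rule: infinite_finite_induct) (auto intro: alg_gen.const alg_gen.add)

lemma alg_gen_uminus: "f \<in> alg_gen X \<Longrightarrow> (\<lambda>M. - f M) \<in> alg_gen X"
  using alg_gen.mult[OF alg_gen.const[of "- 1"], of f] by simp

lemma alg_gen_diff: "f \<in> alg_gen X \<Longrightarrow> g \<in> alg_gen X \<Longrightarrow> (\<lambda>M. f M - g M) \<in> alg_gen X"
  using alg_gen.add[OF _ alg_gen_uminus, of f X g] by simp

lemmas alg_gen_intros = alg_gen.const alg_gen.add alg_gen.mult alg_gen_power alg_gen_uminus
  alg_gen_diff

lemma alg_gen_least:
  assumes "f \<in> alg_gen X" "X \<subseteq> alg_gen Y"
  shows "f \<in> alg_gen Y"
  using assms(1) by induction (use assms(2) in \<open>auto intro: alg_gen.const alg_gen.add alg_gen.mult\<close>)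

text \<open>Serves minimality: a generator that takes different values at two points where all the
  others agree is not generated by the others.\<close>

lemma alg_gen_separates:
  assumes "f \<in> alg_gen X" "\<And>g. g \<in> X \<Longrightarrow> g M = g N"
  shows "f M = f N"
  using assms(1) by induction (use assms(2) in auto)

lemma poly_eval_in_alg_gen:
  assumes "p \<in> poly_ring V"
  shows "(\<lambda>M. poly_eval (\<lambda>v. x v M) p) \<in> alg_gen (x ` V)"
  unfolding poly_eval_eq_sum_keys monom_eval_def
  by (intro alg_gen_sum alg_gen.mult alg_gen.const alg_gen_prod alg_gen_power alg_gen.gen)
    (use assms in \<open>auto simp: poly_ring_def\<close>)

lemma alg_gen_imageE:
  assumes "f \<in> alg_gen (x ` V)"
  obtains p where "p \<in> poly_ring V" "\<And>M. f M = poly_eval (\<lambda>v. x v M) p"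
proof -
  have "\<exists>p\<in>poly_ring V. \<forall>M. f M = poly_eval (\<lambda>v. x v M) p"
    using assms
  proof induction
    case (const c)
    show ?case by (rule bexI[of _ "single 0 c"]) (auto intro: poly_ring_single)
  next
    case (gen f)
    then show ?case by (auto intro!: bexI[of _ "Var _"] poly_ring_Var)
  next
    case (add f g)
    then show ?case by (metis poly_eval_add poly_ring_add)
  next
    case (mult f g)
    then show ?case by (metis poly_eval_mult poly_ring_mult)
  qed
  then show thesis using that by blast
qed


section \<open>Independence of Laurent monomials\<close>

text \<open>Dedekind's argument, with \<open>f\<close> as the multiplication of \<open>T\<close>.
  Subtracting \<open>\<psi> a s\<close> times the relation at \<open>t\<close> from the relation at
  \<open>f s t\<close> removes the term \<open>a\<close> and leaves a shorter relation with
  coefficients \<open>c m * (\<psi> m s - \<psi> a s)\<close>.\<close>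

lemma characters_independent:
  fixes \<psi> :: "'i \<Rightarrow> 'g \<Rightarrow> 'k::field"
  assumes "finite F"
    and mult: "\<And>m s t. m \<in> F \<Longrightarrow> s \<in> T \<Longrightarrow> t \<in> T \<Longrightarrow> f s t \<in> T \<and> \<psi> m (f s t) = \<psi> m s * \<psi> m t"
    and nz: "\<And>m t. m \<in> F \<Longrightarrow> t \<in> T \<Longrightarrow> \<psi> m t \<noteq> 0" and "e \<in> T"
    and dist: "\<And>m n. m \<in> F \<Longrightarrow> n \<in> F \<Longrightarrow> m \<noteq> n \<Longrightarrow> \<exists>t\<in>T. \<psi> m t \<noteq> \<psi> n t"
    and "\<And>t. t \<in> T \<Longrightarrow> (\<Sum>m\<in>F. c m * \<psi> m t) = 0"
  shows "\<forall>m\<in>F. c m = 0"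
  using assms(1,2,3,5,6)
proof (induction F arbitrary: c)
  case (insert a F)
  have 1: "c m * (\<psi> m s - \<psi> a s) = 0" if "m \<in> F" "s \<in> T" for m s
  proof -
    have "(\<Sum>m\<in>F. (c m * (\<psi> m s - \<psi> a s)) * \<psi> m t) = 0" if t: "t \<in> T" for t
    proof -
      have "(\<Sum>m\<in>insert a F. c m * \<psi> m (f s t)) - \<psi> a s * (\<Sum>m\<in>insert a F. c m * \<psi> m t)
          = (\<Sum>m\<in>insert a F. (c m * (\<psi> m s - \<psi> a s)) * \<psi> m t)"
        using insert.prems(1) \<open>s \<in> T\<close> t
        by (simp add: sum_distrib_left sum_subtractf[symmetric] algebra_simps)
      moreover have "(\<Sum>m\<in>insert a F. c m * \<psi> m (f s t)) = 0" "(\<Sum>m\<in>insert a F. c m * \<psi> m t) = 0"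
        using insert.prems(4) insert.prems(1)[of a s t] \<open>s \<in> T\<close> t by auto
      ultimately show ?thesis using insert.hyps by simp
    qed
    then have "\<forall>m\<in>F. c m * (\<psi> m s - \<psi> a s) = 0"
      by (intro insert.IH) (use insert.prems in auto)
    then show ?thesis using that by blast
  qed
  have 2: "c m = 0" if "m \<in> F" for m
  proof -
    obtain t where "t \<in> T" "\<psi> m t \<noteq> \<psi> a t" using insert.prems(3)[of m a] insert.hyps \<open>m \<in> F\<close> by auto
    then show ?thesis using 1[OF \<open>m \<in> F\<close>, of t] by simp
  qed
  \<comment> \<open>With all other coefficients gone, the single point \<open>e\<close> suffices for
    the last one.\<close>
  then have "c a * \<psi> a e = 0" using insert.prems(4)[OF \<open>e \<in> T\<close>] insert.hyps by simp
  then have "c a = 0" using insert.prems(2)[of a e] \<open>e \<in> T\<close> by simp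
  then show ?case using 2 by simp
qed simp

text \<open>In characteristic zero 2 has infinite multiplicative order, so a coordinate set to 2
  reveals its exponent.\<close>

lemma power_int_2_inject:
  assumes "(2::'k::field_char_0) powi m = 2 powi n"
  shows "m = n"
proof -
  have *: "i = 0" if "(2::'k) powi i = 1" "i \<ge> 0" for i
  proof -
    have "(of_nat (2 ^ nat i) :: 'k) = of_nat 1" using that by (simp add: power_int_def)
    then have "(2::nat) ^ nat i = 1" by (rule of_nat_eq_iff[THEN iffD1])
    then show "i = 0" using that by simp
  qed
  have "(2::'k) powi (m - n) = 1" "(2::'k) powi (n - m) = 1"
    using assms by (simp_all add: power_int_diff)
  then show ?thesis using *[of "m - n"] *[of "n - m"] by linarith
qed

text \<open>Distinct exponent vectors give distinct characters of the torus: they are separated by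
  the point with coordinate 2 at a place where they differ and 1 elsewhere.\<close>

lemma laurent_monomials_independent:
  fixes c :: "'i \<Rightarrow> 'k::field_char_0" and E :: "'i \<Rightarrow> 'v \<Rightarrow> int"
  assumes "finite F" "finite V"
    and dist: "\<And>m n. m \<in> F \<Longrightarrow> n \<in> F \<Longrightarrow> (\<And>v. v \<in> V \<Longrightarrow> E m v = E n v) \<Longrightarrow> m = n"
    and zero: "\<And>t. (\<And>v. t v \<noteq> 0) \<Longrightarrow> (\<Sum>m\<in>F. c m * (\<Prod>v\<in>V. t v powi E m v)) = 0"
  shows "\<forall>m\<in>F. c m = 0"
proof (rule characters_independent[where T = "{t. \<forall>v. t v \<noteq> 0}" and e = "\<lambda>_. 1"
      and f = "\<lambda>s t v. s v * t v" and \<psi> = "\<lambda>m t. \<Prod>v\<in>V. t v powi E m v"])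
  fix m n assume mn: "m \<in> F" "n \<in> F" "m \<noteq> n"
  then obtain v where v: "v \<in> V" "E m v \<noteq> E n v" using dist by blast
  define t :: "'v \<Rightarrow> 'k" where "t = (\<lambda>w. if w = v then 2 else 1)"
  have "(\<Prod>w\<in>V. t w powi E l w) = 2 powi E l v" for l
  proof -
    have "(\<Prod>w\<in>V. t w powi E l w) = (\<Prod>w\<in>V. if w = v then 2 powi E l v else 1)"
      by (rule prod.cong) (auto simp: t_def)
    then show ?thesis using v \<open>finite V\<close> by simp
  qed
  then show "\<exists>t\<in>{t :: 'v \<Rightarrow> 'k. \<forall>v. t v \<noteq> 0}. (\<Prod>v\<in>V. t v powi E m v) \<noteq> (\<Prod>v\<in>V. t v powi E n v)"
    using v power_int_2_inject by (intro bexI[of _ t]) (auto simp: t_def)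
qed (use assms in \<open>auto simp: prod.distrib power_int_mult_distrib\<close>)

section \<open>Weights\<close>

text \<open>The sum type merges base change and the rescaling of the two middle arrows into one
  index \<open>h\<close>, so that having weight \<open>d\<close> becomes a single eigenvector
  equation with character \<open>wchar d\<close>.\<close>

fun wact :: "'k::field gl + ('k \<times> 'k) \<Rightarrow> 'k rep \<Rightarrow> 'k rep" where
  "wact (Inl g) M = base_change g M"
| "wact (Inr (t1, t2)) M = torus_act t1 t2 M"

fun wdom :: "'k::field gl + ('k \<times> 'k) \<Rightarrow> bool" where
  "wdom (Inl g) \<longleftrightarrow> is_GL g"
| "wdom (Inr (t1, t2)) \<longleftrightarrow> t1 \<noteq> 0 \<and> t2 \<noteq> 0"

fun wchar :: "wt \<Rightarrow> 'k::field gl + ('k \<times> 'k) \<Rightarrow> 'k" where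
  "wchar ((s_m2, s_m1, s_p1, s_p2), (l1, l2)) (Inl g) =
     det (g_m2 g) powi s_m2 * det (g_m1 g) powi s_m1 * det (g_p1 g) powi s_p1 * det (g_p2 g) powi s_p2"
| "wchar ((s_m2, s_m1, s_p1, s_p2), (l1, l2)) (Inr (t1, t2)) = t1 powi l1 * t2 powi l2"

lemma has_weight_iff:
  "has_weight d f \<longleftrightarrow> (\<forall>h M. wdom h \<longrightarrow> f (wact h M) = wchar d h * f M)"
proof -
  obtain s_m2 s_m1 s_p1 s_p2 l1 l2 where d: "d = ((s_m2, s_m1, s_p1, s_p2), (l1, l2))"
    by (metis surj_pair)
  show ?thesis
    unfolding d by (simp only: split_sum_all split_paired_All has_weight.simps wact.simps wdom.simps wchar.simps) auto
qed

lemma wchar_add: "wdom h \<Longrightarrow> wchar (d + e) h = wchar d h * wchar e h"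
proof -
  obtain a1 a2 a3 a4 a5 a6 where d: "d = ((a1, a2, a3, a4), (a5, a6))" by (metis surj_pair)
  obtain b1 b2 b3 b4 b5 b6 where e: "e = ((b1, b2, b3, b4), (b5, b6))" by (metis surj_pair)
  show "wchar (d + e) h = wchar d h * wchar e h" if "wdom h"
    unfolding d e plus_prod_def using that
    by (cases h rule: wdom.cases) (simp_all add: is_GL_def invertible_det_nz power_int_add mult_ac)
qed

text \<open>Each integer of the degree is read off at an element where one determinant or one torus
  parameter is 2 and all the others are 1.\<close>

lemma wchar_inj:
  assumes "\<And>h :: 'k::field_char_0 gl + ('k \<times> 'k). wdom h \<Longrightarrow> wchar d h = wchar e h"
  shows "d = e"
proof -
  define D :: "'k \<Rightarrow> 'k^2^2" where "D = (\<lambda>c. \<chi> i j. if i = j then (if i = 1 then c else 1) else 0)"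
  have D: "det (D c) = c" for c by (simp add: det_2 D_def)
  have D1: "det (mat c :: 'k^1^1) = c" for c by (simp add: det_1 mat_def)
  let ?h = "\<lambda>a b c d. Inl (GL (D a) (mat b) (mat c) (D d)) :: 'k gl + ('k \<times> 'k)"
  have "wdom (?h a b c d) = (a \<noteq> 0 \<and> b \<noteq> 0 \<and> c \<noteq> 0 \<and> d \<noteq> 0)" for a b c d
    by (simp add: is_GL_def invertible_det_nz D D1)
  then have "wchar d (?h a b c f) = wchar e (?h a b c f)"
    if "a \<noteq> 0" "b \<noteq> 0" "c \<noteq> 0" "f \<noteq> 0" for a b c f
    using assms that by blast
  note 1 = this[of 2 1 1 1] this[of 1 2 1 1] this[of 1 1 2 1] this[of 1 1 1 2]
  note 2 = assms[of "Inr (2, 1)"] assms[of "Inr (1, 2)"]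
  obtain a1 a2 a3 a4 a5 a6 where d: "d = ((a1, a2, a3, a4), (a5, a6))" by (metis surj_pair)
  obtain b1 b2 b3 b4 b5 b6 where e: "e = ((b1, b2, b3, b4), (b5, b6))" by (metis surj_pair)
  show ?thesis
    using 1 2 unfolding d e by (simp add: D D1 power_int_2_inject)
qed

lemma has_weight_const: "has_weight 0 (\<lambda>_. c)"
  by (simp add: zero_prod_def)

lemma has_weight_mult:
  "has_weight d f \<Longrightarrow> has_weight e g \<Longrightarrow> has_weight (d + e) (\<lambda>M. f M * g M)"
  by (auto simp: has_weight_iff wchar_add)

lemma has_weight_scale: "has_weight d f \<Longrightarrow> has_weight d (\<lambda>M. c * f M)"
  using has_weight_mult[OF has_weight_const, of d f c] by simp

lemma has_weight_diff:
  "has_weight d f \<Longrightarrow> has_weight d g \<Longrightarrow> has_weight d (\<lambda>M. f M - g M)"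
  by (auto simp: has_weight_iff right_diff_distrib)

lemma has_weight_power: "has_weight d f \<Longrightarrow> has_weight (\<Sum>i<n. d) (\<lambda>M. f M ^ n)"
proof (induction n)
  case 0
  show ?case using has_weight_const[of 1] by simp
next
  case (Suc n)
  then show ?case using has_weight_mult[OF Suc.prems Suc.IH] by (simp add: add.commute)
qed

lemma has_weight_prod:
  "(\<And>i. i \<in> S \<Longrightarrow> has_weight (e i) (f i)) \<Longrightarrow> has_weight (\<Sum>i\<in>S. e i) (\<lambda>M. \<Prod>i\<in>S. f i M)"
  by (induction S rule: infinite_finite_induct) (auto intro: has_weight_mult has_weight_const)

text \<open>Degrees live in a mere additive monoid, so a multiple of a degree is an iterated sum
  over \<open>i < n\<close>; this is also the shape that \<open>has_weight_power\<close>
  produces.\<close>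

definition mweight :: "('v \<Rightarrow> 'd::comm_monoid_add) \<Rightarrow> ('v \<Rightarrow>\<^sub>0 nat) \<Rightarrow> 'd" where
  "mweight deg m = (\<Sum>v\<in>keys m. \<Sum>i<lookup m v. deg v)"

lemma has_weight_monom_eval:
  assumes "\<And>v. v \<in> keys m \<Longrightarrow> has_weight (deg v) (x v)"
  shows "has_weight (mweight deg m) (\<lambda>M. monom_eval (\<lambda>v. x v M) m)"
  unfolding mweight_def monom_eval_def
  by (intro has_weight_prod has_weight_power assms)

lemma mweight_superset:
  "finite V \<Longrightarrow> keys m \<subseteq> V \<Longrightarrow> mweight deg m = (\<Sum>v\<in>V. \<Sum>i<lookup m v. deg v)"
  unfolding mweight_def by (rule sum.mono_neutral_left) (auto simp: in_keys_iff)

lemma sum_lessThan_const_add: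
  "(\<Sum>i<m + n :: nat. d) = (\<Sum>i<m. d) + (\<Sum>i<n. d :: 'd::comm_monoid_add)"
  by (induction n) (auto simp: add_ac)

lemma mweight_add: "mweight deg (m + n) = mweight deg m + mweight deg n"
proof -
  let ?V = "keys m \<union> keys n"
  have "mweight deg l = (\<Sum>v\<in>?V. \<Sum>i<lookup l v. deg v)" if "keys l \<subseteq> ?V" for l
    by (rule mweight_superset) (use that in auto)
  then show ?thesis
    using keys_add[of m n] by (simp add: lookup_add sum_lessThan_const_add sum.distrib)
qed

lemma mweight_0 [simp]: "mweight deg 0 = 0"
  and mweight_single: "mweight deg (single v n) = (\<Sum>i<n. deg v)"
  by (simp_all add: mweight_def)


section \<open>Hypersurface rings of functions\<close>

lemma sum_fun_apply: "(\<Sum>i\<in>S. f i) M = (\<Sum>i\<in>S. f i M)"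
  by (induction S rule: infinite_finite_induct) auto

lemma lookup_sum_single:
  "finite S \<Longrightarrow> lookup (\<Sum>m\<in>S. single m (c m)) k = (if k \<in> S then c k else 0)"
  by (simp add: lookup_sum lookup_single when_def)

definition normal_monoms :: "'v set \<Rightarrow> ('v \<Rightarrow>\<^sub>0 nat) \<Rightarrow> ('v \<Rightarrow>\<^sub>0 nat) set" where
  "normal_monoms V L = {m. keys m \<subseteq> V \<and> \<not> (\<forall>v. lookup L v \<le> lookup m v)}"

text \<open>The monomials in \<open>V\<close> not divisible by the leading monomial \<open>L\<close> of the relation \<open>L - \<rho>\<close> span
  the algebra. Their independence is only required on the divisor \<open>x u = 0\<close>; it follows everywhere,
  because a vanishing combination is then divisible by \<open>x u\<close>, which can be cancelled.\<close>

locale hypersurface =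
  fixes x :: "'v \<Rightarrow> 'k::field_char_0 rep \<Rightarrow> 'k" and V :: "'v set" and L :: "'v \<Rightarrow>\<^sub>0 nat"
    and \<rho> :: "('v, 'k) mpol" and u v0 :: 'v
  assumes finite_V: "finite V" and u_V: "u \<in> V"
    and L_V: "keys L \<subseteq> V" and L_v0: "lookup L v0 \<noteq> 0"
    and \<rho>_V: "\<rho> \<in> poly_ring V" and \<rho>_v0: "\<And>m. m \<in> keys \<rho> \<Longrightarrow> lookup m v0 = 0"
    and rel: "\<And>M. poly_eval (\<lambda>v. x v M) (single L 1 - \<rho>) = 0"
    and x_poly: "\<And>v. v \<in> V \<Longrightarrow> x v \<in> poly_funs"
    and x_u_nonzero: "\<exists>N. x u N \<noteq> 0"
    and indep_u: "\<And>n. keys n \<subseteq> normal_monoms V L \<Longrightarrow> (\<And>m. m \<in> keys n \<Longrightarrow> lookup m u = 0) \<Longrightarrow>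
      (\<And>M. x u M = 0 \<Longrightarrow> poly_eval (\<lambda>v. x v M) n = 0) \<Longrightarrow> n = 0"
begin

abbreviation "NF \<equiv> normal_monoms V L"
abbreviation "ev M \<equiv> poly_eval (\<lambda>v. x v M)"
abbreviation "mev m M \<equiv> monom_eval (\<lambda>v. x v M) m"

definition reducible :: "('v, 'k) mpol \<Rightarrow> bool" where
  "reducible p \<longleftrightarrow> (\<exists>q n. q \<in> poly_ring V \<and> keys n \<subseteq> NF \<and> p = q * (single L 1 - \<rho>) + n)"

lemma reducible_add:
  assumes "reducible p" "reducible p'"
  shows "reducible (p + p')"
proof -
  obtain q n q' n' where "q \<in> poly_ring V" "keys n \<subseteq> NF" "p = q * (single L 1 - \<rho>) + n"
    "q' \<in> poly_ring V" "keys n' \<subseteq> NF" "p' = q' * (single L 1 - \<rho>) + n'"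
    using assms unfolding reducible_def by blast
  then show ?thesis
    unfolding reducible_def using keys_add[of n n']
    by (rule_tac exI[of _ "q + q'"], rule_tac exI[of _ "n + n'"])
      (auto intro: poly_ring_add simp: distrib_right)
qed

lemma reducible_sum: "(\<And>i. i \<in> S \<Longrightarrow> reducible (f i)) \<Longrightarrow> reducible (sum f S)"
proof (induction S rule: infinite_finite_induct)
  case (insert i S)
  then show ?case by (simp add: reducible_add)
qed (auto simp: reducible_def intro!: exI[of _ 0])

text \<open>A multiple of \<open>L\<close> is rewritten by means of \<open>\<rho>\<close>. The
  exponent of \<open>v0\<close> drops strictly, since \<open>v0\<close> divides \<open>L\<close> and
  occurs in no monomial of \<open>\<rho>\<close>, so the rewriting ends.\<close>

lemma reducible_single: "keys m \<subseteq> V \<Longrightarrow> reducible (single m c)"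
proof (induction "lookup m v0" arbitrary: m c rule: less_induct)
  case less
  show ?case
  proof (cases "m \<in> NF")
    case True
    then show ?thesis
      unfolding reducible_def by (rule_tac exI[of _ 0], rule_tac exI[of _ "single m c"]) auto
  next
    case False
    then have le: "lookup L v \<le> lookup m v" for v
      using less.prems by (auto simp: normal_monoms_def)
    define m' where "m' = m - L"
    have m: "m = m' + L"
      using le by (intro poly_mapping_eqI) (simp add: m'_def lookup_add lookup_minus)
    have m'_V: "keys m' \<subseteq> V" using less.prems unfolding m by (auto simp: lookup_add in_keys_iff)
    have "reducible (single (m' + k) (c * lookup \<rho> k))" if "k \<in> keys \<rho>" for k
    proof (rule less.hyps)
      show "lookup (m' + k) v0 < lookup m v0"
        using L_v0 \<rho>_v0[OF that] by (simp add: m lookup_add)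
      show "keys (m' + k) \<subseteq> V"
        using keys_add[of m' k] m'_V \<rho>_V that by (auto simp: poly_ring_def)
    qed
    then have "reducible (\<Sum>k\<in>keys \<rho>. single (m' + k) (c * lookup \<rho> k))"
      by (rule reducible_sum)
    moreover have "(\<Sum>k\<in>keys \<rho>. single (m' + k) (c * lookup \<rho> k)) = single m' c * \<rho>"
      by (subst (3) mpol_sum_single[of \<rho>]) (simp add: sum_distrib_left mult_single)
    moreover have "reducible (single m' c * (single L 1 - \<rho>))"
      unfolding reducible_def by (rule_tac exI[of _ "single m' c"], rule_tac exI[of _ 0])
        (simp add: poly_ring_single m'_V)
    moreover have "single m c = single m' c * (single L 1 - \<rho>) + single m' c * \<rho>"
      by (simp add: m right_diff_distrib mult_single)
    ultimately show ?thesis using reducible_add by metis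
  qed
qed

lemma reduce:
  assumes "p \<in> poly_ring V"
  obtains q n where "q \<in> poly_ring V" "keys n \<subseteq> NF" "p = q * (single L 1 - \<rho>) + n"
proof -
  have "reducible (\<Sum>m\<in>keys p. single m (lookup p m))"
    using assms by (intro reducible_sum reducible_single) (auto simp: poly_ring_def)
  then show thesis using that unfolding mpol_sum_single[symmetric] reducible_def by blast
qed

lemma NF_poly_ring: "keys n \<subseteq> NF \<Longrightarrow> n \<in> poly_ring V"
  by (auto simp: poly_ring_def normal_monoms_def)

lemma reduce_alg_gen:
  assumes "f \<in> alg_gen (x ` V)"
  obtains n where "keys n \<subseteq> NF" "\<And>M. f M = ev M n"
proof -
  obtain p where p: "p \<in> poly_ring V" "\<And>M. f M = ev M p" using assms by (rule alg_gen_imageE) blast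
  obtain q n where "q \<in> poly_ring V" "keys n \<subseteq> NF" "p = q * (single L 1 - \<rho>) + n"
    using p(1) by (rule reduce)
  then show thesis using that p(2) rel by simp
qed

lemma alg_gen_subset_poly_funs: "alg_gen (x ` V) \<subseteq> poly_funs"
  using alg_gen_least[of _ "x ` V" coord_funs] x_poly unfolding poly_funs_def by blast

lemma ev_poly_funs: "keys n \<subseteq> NF \<Longrightarrow> (\<lambda>M. ev M n) \<in> poly_funs"
  using poly_eval_in_alg_gen[OF NF_poly_ring] alg_gen_subset_poly_funs by blast

text \<open>On the divisor of \<open>x u\<close> only the monomials of \<open>n\<close> free of
  \<open>u\<close> survive, and their combination vanishes there; \<open>indep_u\<close> makes it
  zero. So \<open>u\<close> divides every monomial of \<open>n\<close> and cancels. The last two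
  conclusions record what happens to the exponents, for the descent in
  \<open>normal_independent\<close>.\<close>

lemma divide_by_u:
  assumes n: "keys n \<subseteq> NF" and f: "f \<in> poly_funs" "\<And>M. f M * x u M = ev M n"
  obtains n' where "keys n' \<subseteq> NF" "\<And>M. f M = ev M n'" "\<And>m. m \<in> keys n \<Longrightarrow> lookup m u \<noteq> 0"
    "\<And>m. m \<in> keys n \<Longrightarrow> m - single u 1 \<in> keys n'"
proof -
  let ?K0 = "{m \<in> keys n. lookup m u = 0}"
  define n0 where "n0 = (\<Sum>m\<in>?K0. single m (lookup n m))"
  have n0: "lookup n0 m = (if m \<in> ?K0 then lookup n m else 0)" for m
    unfolding n0_def by (rule lookup_sum_single) simp
  have "n0 = 0"
  proof (rule indep_u)
    show "keys n0 \<subseteq> NF" using n n0 by (auto simp: in_keys_iff split: if_splits)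
    show "lookup m u = 0" if "m \<in> keys n0" for m
      using that n0 by (auto simp: in_keys_iff split: if_splits)
    show "ev M n0 = 0" if "x u M = 0" for M
    proof -
      have "mev m M = 0" if "lookup m u \<noteq> 0" for m
        unfolding monom_eval_def using that \<open>x u M = 0\<close>
        by (auto simp: in_keys_iff intro!: prod_zero bexI[of _ u])
      then have "ev M n = (\<Sum>m\<in>?K0. lookup n m * mev m M)"
        unfolding poly_eval_eq_sum_keys by (intro sum.mono_neutral_right) auto
      also have "\<dots> = ev M n0"
        by (simp add: n0_def poly_eval_sum)
      finally show ?thesis using f(2)[of M] \<open>x u M = 0\<close> by simp
    qed
  qed
  then have nz: "lookup m u \<noteq> 0" if "m \<in> keys n" for m
    using n0[of m] that by (auto simp: in_keys_iff split: if_splits)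
  let ?d = "\<lambda>m. m - single u 1"
  have d: "m = ?d m + single u 1" if "m \<in> keys n" for m
    using nz[OF that] by (intro poly_mapping_eqI) (auto simp: lookup_add lookup_minus lookup_single when_def)
  have inj: "inj_on ?d (keys n)" by (rule inj_on_inverseI[where g = "\<lambda>m. m + single u 1"]) (rule d[symmetric])
  define n' where "n' = (\<Sum>m\<in>keys n. single (?d m) (lookup n m))"
  have n': "n' = (\<Sum>k\<in>?d ` keys n. single k (lookup n (k + single u 1)))"
    unfolding n'_def using inj d by (subst sum.reindex) (auto intro!: sum.cong)
  have ln': "lookup n' k = (if k \<in> ?d ` keys n then lookup n (k + single u 1) else 0)" for k
    unfolding n' by (rule lookup_sum_single) simp
  have keys_n': "keys n' = ?d ` keys n"
    using ln' by (auto simp: in_keys_iff d[symmetric, unfolded in_keys_iff] simp del: One_nat_def split: if_splits)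
  have "mev m M = mev (?d m) M * x u M" if "m \<in> keys n" for m M
    using monom_eval_add[of "\<lambda>v. x v M" "?d m" "single u 1"] by (simp add: d[OF that, symmetric] del: One_nat_def)
  then have "ev M n = ev M n' * x u M" for M
    unfolding n'_def poly_eval_sum sum_distrib_right poly_eval_eq_sum_keys[of _ n]
    by (intro sum.cong refl) (simp add: mult_ac)
  then have zero: "(f M - ev M n') * x u M = 0" for M using f(2)[of M] by (simp add: algebra_simps)
  \<comment> \<open>A divisor of a normal monomial is normal.\<close>
  have keys_NF: "keys n' \<subseteq> NF"
  proof
    fix k assume "k \<in> keys n'"
    then obtain m where m: "m \<in> keys n" "k = ?d m" using keys_n' by blast
    have le: "lookup k v \<le> lookup m v" for v by (simp add: m lookup_minus)
    have "keys k \<subseteq> keys m" using le by (metis in_keys_iff le_zero_eq subsetI)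
    moreover have "m \<in> NF" using n m by blast
    ultimately show "k \<in> NF"
      using le unfolding normal_monoms_def by (auto intro: order_trans)
  qed
  \<comment> \<open>Cancelling \<open>x u\<close> is legitimate because polynomial functions form a
    domain and \<open>x u\<close> is not identically zero.\<close>
  have "(\<lambda>M. f M - ev M n') \<in> poly_funs"
    using f(1) ev_poly_funs[OF keys_NF] unfolding poly_funs_def by (rule alg_gen_diff)
  moreover obtain N where "x u N \<noteq> 0" using x_u_nonzero by blast
  ultimately have "f M - ev M n' = 0" for M
    using poly_funs_domain[OF _ x_poly[OF u_V] zero] by blast
  then show thesis
    using that[of n'] keys_NF nz keys_n' by auto
qed

text \<open>Infinite descent: the zero function times \<open>x u\<close> equals
  \<open>ev M n\<close>, so \<open>n\<close> can be divided by \<open>u\<close> again and again, and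
  the exponent of \<open>u\<close> in each of its monomials would exceed every bound.\<close>

lemma normal_independent:
  assumes "keys n \<subseteq> NF" "\<And>M. ev M n = 0"
  shows "n = 0"
proof -
  have zero: "(\<lambda>_. 0) \<in> poly_funs" unfolding poly_funs_def by (rule alg_gen.const)
  have "k \<le> lookup m u" if "keys n \<subseteq> NF" "\<And>M. ev M n = 0" "m \<in> keys n" for k n m
    using that
  proof (induction k arbitrary: n m)
    case (Suc k)
    obtain n' where n': "keys n' \<subseteq> NF" "\<And>M. 0 = ev M n'" "\<And>m. m \<in> keys n \<Longrightarrow> lookup m u \<noteq> 0"
      "\<And>m. m \<in> keys n \<Longrightarrow> m - single u 1 \<in> keys n'"
      using divide_by_u[OF Suc.prems(1) zero] Suc.prems(2) by auto
    have "k \<le> lookup (m - single u 1) u"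
      using Suc.IH[of n'] n' Suc.prems(3) by auto
    then show ?case using n'(3)[OF Suc.prems(3)] by (simp add: lookup_minus)
  qed simp
  then have "m \<notin> keys n" for m using assms not_less_eq_eq by blast
  then show ?thesis by (intro poly_mapping_eqI) (auto simp: in_keys_iff)
qed

text \<open>The remainder of a relation after reduction is a vanishing combination of normal
  monomials, hence zero.\<close>

lemma relations_eq: "relations x V = {q * (single L 1 - \<rho>) | q. q \<in> poly_ring V}"
proof (intro subset_antisym subsetI)
  fix p assume "p \<in> relations x V"
  then have p: "p \<in> poly_ring V" "\<And>M. ev M p = 0" by (auto simp: relations_def)
  obtain q n where q: "q \<in> poly_ring V" "keys n \<subseteq> NF" "p = q * (single L 1 - \<rho>) + n"
    using p(1) by (rule reduce)
  then have "n = 0" using normal_independent p(2) rel by simp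
  then show "p \<in> {q * (single L 1 - \<rho>) | q. q \<in> poly_ring V}" using q by auto
next
  fix p assume "p \<in> {q * (single L 1 - \<rho>) | q. q \<in> poly_ring V}"
  then obtain q where q: "q \<in> poly_ring V" "p = q * (single L 1 - \<rho>)" by blast
  have "single L 1 - \<rho> \<in> poly_ring V"
    by (intro poly_ring_diff poly_ring_single L_V \<rho>_V)
  then show "p \<in> relations x V"
    using q rel by (simp add: relations_def poly_ring_mult)
qed

text \<open>\<open>divide_by_u\<close> removes the factors \<open>x u\<close> one at a time. This
  brings a membership known only after inverting \<open>x u\<close> back to the algebra
  itself.\<close>

lemma saturated:
  assumes "f \<in> poly_funs" "(\<lambda>M. f M * x u M ^ N) \<in> alg_gen (x ` V)"
  shows "f \<in> alg_gen (x ` V)"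
  using assms
proof (induction N arbitrary: f)
  case (Suc N)
  let ?g = "\<lambda>M. f M * x u M ^ N"
  have g: "?g \<in> poly_funs"
    using Suc.prems(1) x_poly[OF u_V] unfolding poly_funs_def by (intro alg_gen.mult alg_gen_power)
  obtain n where n: "keys n \<subseteq> NF" "\<And>M. f M * x u M ^ Suc N = ev M n"
    using Suc.prems(2) by (rule reduce_alg_gen) blast
  obtain n' where "keys n' \<subseteq> NF" "\<And>M. ?g M = ev M n'"
    using divide_by_u[OF n(1) g] n(2) by (metis mult.assoc power_Suc2)
  then have "?g \<in> alg_gen (x ` V)"
    using poly_eval_in_alg_gen[OF NF_poly_ring, of n' x] by presburger
  then show ?case using Suc by blast
qed simp

text \<open>Normal monomials are independent weight vectors. For \<open>f\<close> of weight
  \<open>d\<close>, the identity \<open>f (wact h M) = wchar d h * f M\<close> is a relation among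
  them whose coefficients must vanish; as characters separate degrees, only monomials of weight
  \<open>d\<close> occur in \<open>f\<close>.\<close>

lemma component_dim:
  assumes deg: "\<And>v. v \<in> V \<Longrightarrow> has_weight (deg v) (x v)"
    and fin: "finite {m \<in> NF. mweight deg m = d}"
  shows "(\<exists>B. finite B \<and> component (alg_gen (x ` V)) d \<subseteq> module.span scale_fun B) \<and>
    vector_space.dim scale_fun (component (alg_gen (x ` V)) d) = card {m \<in> NF. mweight deg m = d}"
proof -
  interpret vs: vector_space "scale_fun :: 'k \<Rightarrow> ('k rep \<Rightarrow> 'k) \<Rightarrow> _"
    by (rule vector_space_scale_fun)
  let ?S = "{m \<in> NF. mweight deg m = d}" and ?C = "component (alg_gen (x ` V)) d"
  define B where "B = mev ` ?S"
  have sum_zero: "\<forall>m\<in>F. c m = 0"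
    if F: "finite F" "F \<subseteq> NF" "\<And>M. (\<Sum>m\<in>F. c m * mev m M) = 0" for F c
  proof -
    define n where "n = (\<Sum>m\<in>F. single m (c m))"
    have l: "lookup n k = (if k \<in> F then c k else 0)" for k
      unfolding n_def using F(1) by (rule lookup_sum_single)
    have "n = 0"
    proof (rule normal_independent)
      show "keys n \<subseteq> NF" using F(2) l by (auto simp: in_keys_iff split: if_splits)
      show "ev M n = 0" for M using F(3)[of M] by (simp add: n_def poly_eval_sum)
    qed
    then show ?thesis using l by (metis lookup_zero)
  qed
  have inj: "inj_on mev NF"
  proof (rule inj_onI, rule ccontr)
    fix m m' assume m: "m \<in> NF" "m' \<in> NF" "mev m = mev m'" "m \<noteq> m'"
    have "\<forall>k\<in>{m, m'}. (if k = m then 1 else - 1 :: 'k) = 0"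
      by (rule sum_zero) (use m in \<open>auto simp: fun_eq_iff\<close>)
    then show False by simp
  qed
  have mev_alg: "mev m \<in> alg_gen (x ` V)" if "m \<in> NF" for m
    using poly_eval_in_alg_gen[of "single m 1" V x] that
    by (simp add: poly_ring_single normal_monoms_def)
  have mev_weight: "has_weight (mweight deg m) (mev m)" if "m \<in> NF" for m
    by (rule has_weight_monom_eval) (use deg that in \<open>auto simp: normal_monoms_def\<close>)
  have B_C: "B \<subseteq> ?C"
    using mev_alg mev_weight by (auto simp: B_def component_def)
  have C_B: "?C \<subseteq> vs.span B"
  proof
    fix f assume f: "f \<in> ?C"
    then obtain n where n: "keys n \<subseteq> NF" "\<And>M. f M = ev M n"
      using reduce_alg_gen unfolding component_def by blast
    have fw: "has_weight d f" using f by (simp add: component_def)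
    have w: "mweight deg m = d" if m: "m \<in> keys n" for m
    proof (rule wchar_inj)
      fix h :: "'k gl + 'k \<times> 'k" assume h: "wdom h"
      have "(\<Sum>m\<in>keys n. (lookup n m * (wchar (mweight deg m) h - wchar d h)) * mev m M) = 0" for M
      proof -
        have "f (wact h M) = (\<Sum>m\<in>keys n. lookup n m * (wchar (mweight deg m) h * mev m M))"
          unfolding n(2) poly_eval_eq_sum_keys
          using mev_weight n(1) h by (intro sum.cong refl) (auto simp: has_weight_iff)
        moreover have "f (wact h M) = wchar d h * (\<Sum>m\<in>keys n. lookup n m * mev m M)"
          using fw h unfolding has_weight_iff poly_eval_eq_sum_keys[symmetric] n(2)[symmetric] by blast
        ultimately show ?thesis
          by (simp add: sum_distrib_left sum_subtractf algebra_simps)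
      qed
      then have "\<forall>m\<in>keys n. lookup n m * (wchar (mweight deg m) h - wchar d h) = 0"
        using n(1) by (intro sum_zero) auto
      then show "wchar (mweight deg m) h = wchar d h" using m by (auto simp: in_keys_iff)
    qed
    have f_sum: "f = (\<Sum>m\<in>keys n. scale_fun (lookup n m) (mev m))"
      by (rule ext) (simp add: n(2) sum_fun_apply scale_fun_def poly_eval_eq_sum_keys)
    have "mev m \<in> B" if "m \<in> keys n" for m
      using w n(1) that by (auto simp: B_def)
    then show "f \<in> vs.span B"
      unfolding f_sum by (intro vs.span_sum vs.span_scale vs.span_base)
  qed
  have finB: "finite B" using fin by (simp add: B_def)
  have ind: "vs.independent B"
  proof
    assume "vs.dependent B"
    then obtain c where c: "\<exists>b\<in>B. c b \<noteq> 0" "(\<Sum>b\<in>B. scale_fun (c b) b) = 0"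
      using vs.dependent_finite[OF finB] by blast
    have "(\<Sum>m\<in>?S. c (mev m) * mev m M) = 0" for M
    proof -
      have "(\<Sum>m\<in>?S. c (mev m) * mev m M) = (\<Sum>b\<in>B. c b * b M)"
        unfolding B_def by (subst sum.reindex) (auto intro: inj_on_subset[OF inj])
      also have "\<dots> = (\<Sum>b\<in>B. scale_fun (c b) b) M" by (simp add: sum_fun_apply scale_fun_def)
      finally show ?thesis using c(2) by simp
    qed
    then have "\<forall>m\<in>?S. c (mev m) = 0" using fin by (intro sum_zero) auto
    then show False using c(1) by (auto simp: B_def)
  qed
  have "vs.span B = vs.span ?C"
    using vs.span_mono[OF B_C] vs.span_mono[OF C_B] by (simp add: vs.span_span)
  then have "vs.dim ?C = card B" using ind by (rule vs.dim_eq_card)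
  also have "\<dots> = card ?S" unfolding B_def by (intro card_image inj_on_subset[OF inj]) auto
  finally show ?thesis using finB C_B by blast
qed

end

section \<open>Counting series of monomials\<close>

text \<open>Connects the iterated addition in \<open>geom\<close> with the iterated sums in
  \<open>mweight\<close>.\<close>

lemma funpow_add_eq_sum: "(((+) s) ^^ n) 0 = (\<Sum>i<n. s :: 'd::ab_group_add)"
  by (induction n) (auto simp: add.commute)

lemma series_mult_commute: "f \<star> g = g \<star> f"
proof
  fix d
  show "(f \<star> g) d = (g \<star> f) d"
    unfolding series_mult_def
    by (rule sum.reindex_bij_witness[of _ "\<lambda>a. d - a" "\<lambda>a. d - a"]) auto
qed

lemma zpow_0_mult: "zpow 0 \<star> f = f"
proof
  fix d
  have "(zpow 0 \<star> f) d = (\<Sum>a\<in>{0}. zpow 0 a * f (d - a))"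
    unfolding series_mult_def
    by (rule sum.mono_neutral_left) (auto simp: zpow_def split: if_splits)
  then show "(zpow 0 \<star> f) d = f d" by (simp add: zpow_def)
qed

lemma binomial_mult:
  assumes "s \<noteq> 0"
  shows "(\<lambda>d. zpow 0 d + c * zpow s d) \<star> f = (\<lambda>d. f d + c * f (d - s))"
proof
  fix d
  let ?b = "\<lambda>d. zpow 0 d + c * zpow s d"
  have "(?b \<star> f) d = (\<Sum>a\<in>{0, s}. ?b a * f (d - a))"
    unfolding series_mult_def
    by (rule sum.mono_neutral_left) (auto simp: zpow_def split: if_splits)
  then show "(?b \<star> f) d = f d + c * f (d - s)" using assms by (simp add: zpow_def)
qed

text \<open>A sum over an infinite index set defaults to 0, hence the finiteness assumption. Both
  parts are extended to the union of their supports, because cancellation can make the support of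
  the combination smaller.\<close>

lemma binomial_mult_assoc:
  assumes "s \<noteq> 0" and fin: "\<And>d. finite {a. g a \<noteq> 0 \<and> h (d - a) \<noteq> 0}"
  shows "(\<lambda>d. zpow 0 d + c * zpow s d) \<star> g \<star> h = (\<lambda>d. (g \<star> h) d + c * (g \<star> h) (d - s))"
proof
  fix d
  let ?f = "\<lambda>a. g a + c * g (a - s)"
  let ?A = "{a. g a \<noteq> 0 \<and> h (d - a) \<noteq> 0}" and ?B = "{a. g (a - s) \<noteq> 0 \<and> h (d - a) \<noteq> 0}"
  \<comment> \<open>Translation by \<open>s\<close> carries the index set of the coefficient at
    \<open>d - s\<close> onto \<open>?B\<close>.\<close>
  have B: "?B = (\<lambda>a. a + s) ` {a. g a \<noteq> 0 \<and> h (d - s - a) \<noteq> 0}"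
  proof (intro subset_antisym subsetI)
    fix a assume "a \<in> ?B"
    then show "a \<in> (\<lambda>a. a + s) ` {a. g a \<noteq> 0 \<and> h (d - s - a) \<noteq> 0}"
      by (intro image_eqI[of _ _ "a - s"]) (auto simp: algebra_simps)
  qed (auto simp: algebra_simps)
  have finB: "finite ?B" unfolding B using fin by blast
  have "(?f \<star> h) d = (\<Sum>a\<in>?A \<union> ?B. ?f a * h (d - a))"
    unfolding series_mult_def by (rule sum.mono_neutral_left) (use fin finB in auto)
  also have "\<dots> = (\<Sum>a\<in>?A \<union> ?B. g a * h (d - a)) + c * (\<Sum>a\<in>?A \<union> ?B. g (a - s) * h (d - a))"
    by (simp add: sum.distrib sum_distrib_left algebra_simps)
  also have "(\<Sum>a\<in>?A \<union> ?B. g a * h (d - a)) = (g \<star> h) d"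
    unfolding series_mult_def by (rule sum.mono_neutral_right) (use fin finB in auto)
  also have "(\<Sum>a\<in>?A \<union> ?B. g (a - s) * h (d - a)) = (\<Sum>a\<in>?B. g (a - s) * h (d - a))"
    by (rule sum.mono_neutral_right) (use fin finB in auto)
  also have "\<dots> = (g \<star> h) (d - s)"
    unfolding B series_mult_def by (subst sum.reindex) (auto simp: algebra_simps inj_on_def)
  finally show "((\<lambda>d. zpow 0 d + c * zpow s d) \<star> g \<star> h) d = (g \<star> h) d + c * (g \<star> h) (d - s)"
    unfolding binomial_mult[OF assms(1)] .
qed

text \<open>An additive height that is positive on every variable bounds the exponents of a monomial
  by the height of its degree. This keeps the fibres finite and the multiples of the degree of a
  variable distinct.\<close>

locale positively_graded =
  fixes deg :: "'v \<Rightarrow> 'd::ab_group_add" and ht :: "'d \<Rightarrow> int"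
  assumes ht_add: "ht (a + b) = ht a + ht b" and ht_pos: "ht (deg v) > 0"
begin

definition fibre :: "'v set \<Rightarrow> 'd \<Rightarrow> ('v \<Rightarrow>\<^sub>0 nat) set" where
  "fibre V d = {m. keys m \<subseteq> V \<and> mweight deg m = d}"

definition cnt :: "'v set \<Rightarrow> 'd series" where
  "cnt V = (\<lambda>d. int (card (fibre V d)))"

lemma ht_0: "ht 0 = 0"
  using ht_add[of 0 0] by simp

lemma ht_sum: "ht (sum f S) = (\<Sum>i\<in>S. ht (f i))"
  by (induction S rule: infinite_finite_induct) (auto simp: ht_add ht_0)

lemma deg_nonzero: "deg v \<noteq> 0"
  using ht_pos[of v] ht_0 by auto

lemma multiple_deg_inject:
  assumes "(\<Sum>i<m. deg v) = (\<Sum>i<n. deg v)"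
  shows "m = (n :: nat)"
proof -
  have "ht (\<Sum>i<m. deg v) = ht (\<Sum>i<n. deg v)" using assms by simp
  then have "int m * ht (deg v) = int n * ht (deg v)" by (simp add: ht_sum)
  then show ?thesis using ht_pos[of v] by simp
qed

lemma lookup_le_ht: "lookup m v \<le> nat (ht (mweight deg m))"
proof (cases "v \<in> keys m")
  case True
  have nonneg: "0 \<le> int (lookup m w) * ht (deg w)" for w
    using ht_pos[of w] by simp
  have "int (lookup m v) \<le> int (lookup m v) * ht (deg v)"
    using ht_pos[of v] by (simp add: mult_le_cancel_left1)
  also have "\<dots> \<le> (\<Sum>w\<in>keys m. int (lookup m w) * ht (deg w))"
    using True nonneg by (intro member_le_sum) auto
  also have "\<dots> = ht (mweight deg m)" by (simp add: mweight_def ht_sum)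
  finally show ?thesis by simp
qed (simp add: in_keys_iff)

lemma finite_fibre:
  assumes "finite V"
  shows "finite (fibre V d)"
proof -
  let ?F = "{f. \<forall>v. (v \<in> V \<longrightarrow> f v \<in> {..nat (ht d)}) \<and> (v \<notin> V \<longrightarrow> f v = 0)}"
  have "lookup ` fibre V d \<subseteq> ?F"
    using lookup_le_ht by (force simp: fibre_def in_keys_iff)
  moreover have "finite ?F" using assms by (intro finite_set_of_finite_funs) auto
  ultimately have "finite (lookup ` fibre V d)" by (rule finite_subset)
  then show ?thesis by (rule finite_imageD) (auto simp: inj_on_def intro: poly_mapping_eqI)
qed

lemma cnt_empty: "cnt {} = zpow 0"
proof
  fix d
  have "fibre {} d = (if d = 0 then {0} else {})"
    by (auto simp: fibre_def)
  then show "cnt {} d = zpow 0 d" by (simp add: cnt_def zpow_def)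
qed

text \<open>A monomial in \<open>insert v V\<close> is a monomial in \<open>V\<close> times a power
  of \<open>v\<close>. Grouping by the degree \<open>w m\<close> of the first factor gives the
  convolution: once this degree is fixed, so is the power of \<open>v\<close>, because the multiples
  of \<open>deg v\<close> are distinct. The index set of the convolution is the image under
  \<open>w\<close> of a finite fibre, which also gives the second claim.\<close>

lemma
  assumes V: "finite V" "v \<notin> V"
  shows cnt_insert: "cnt V \<star> geom (deg v) = cnt (insert v V)"
    and finite_cnt_geom: "finite {a. cnt V a \<noteq> 0 \<and> geom (deg v) (d - a) \<noteq> 0}"
proof -
  define w where "w = (\<lambda>m. mweight deg (m - single v (lookup m v)))"
  let ?F = "fibre (insert v V)" and ?A = "\<lambda>d. {a. cnt V a \<noteq> 0 \<and> geom (deg v) (d - a) \<noteq> 0}"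
  have geom: "geom (deg v) e = (if \<exists>n :: nat. e = (\<Sum>i<n. deg v) then 1 else 0)" for e
    by (simp add: geom_def funpow_add_eq_sum)
  have cnt: "cnt V a \<noteq> 0 \<longleftrightarrow> (\<exists>m. m \<in> fibre V a)" for a
    using finite_fibre[OF V(1), of a] by (auto simp: cnt_def)
  have restr: "m - single v (lookup m v) \<in> fibre V (w m)"
    "m = (m - single v (lookup m v)) + single v (lookup m v)" if "m \<in> ?F d" for m d
  proof -
    have "keys (m - single v (lookup m v)) \<subseteq> V"
      using that by (auto simp: fibre_def subset_iff in_keys_iff lookup_minus lookup_single when_def split: if_splits)
    then show "m - single v (lookup m v) \<in> fibre V (w m)" by (auto simp: fibre_def w_def)
    show "m = (m - single v (lookup m v)) + single v (lookup m v)"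
      by (intro poly_mapping_eqI) (simp add: lookup_add lookup_minus lookup_single when_def)
  qed
  have d_eq: "d = w m + (\<Sum>i<lookup m v. deg v)" if "m \<in> ?F d" for m d
    using that arg_cong[OF restr(2)[OF that], of "mweight deg"]
    by (simp add: fibre_def mweight_add mweight_single w_def)
  have ext: "m + single v n \<in> ?F (a + (\<Sum>i<n. deg v))" "w (m + single v n) = a" if "m \<in> fibre V a" for m n a
  proof -
    show "m + single v n \<in> ?F (a + (\<Sum>i<n. deg v))"
      using that keys_add[of m "single v n"]
      by (auto simp: fibre_def mweight_add mweight_single split: if_splits)
    have "lookup m v = 0" using that V(2) by (auto simp: fibre_def in_keys_iff)
    then have "m + single v n - single v (lookup (m + single v n) v) = m"
      by (intro poly_mapping_eqI) (simp add: lookup_add lookup_minus)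
    then show "w (m + single v n) = a" using that by (simp add: w_def fibre_def)
  qed
  have A: "?A d = w ` ?F d" for d
  proof (intro subset_antisym subsetI)
    fix a assume "a \<in> ?A d"
    then obtain m and n :: nat where "m \<in> fibre V a" "d - a = (\<Sum>i<n. deg v)"
      by (auto simp: cnt geom split: if_splits)
    then show "a \<in> w ` ?F d"
      using ext[of m a n] by (intro image_eqI[of _ _ "m + single v n"]) (auto simp: algebra_simps)
  next
    fix a assume "a \<in> w ` ?F d"
    then obtain m where m: "m \<in> ?F d" "a = w m" by blast
    then show "a \<in> ?A d"
      using restr(1)[OF m(1)] d_eq[OF m(1)] by (auto simp: cnt geom algebra_simps)
  qed
  have finF: "finite (?F d)" for d using V by (intro finite_fibre) simp
  show "finite (?A d)" unfolding A using finF by simp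
  show "cnt V \<star> geom (deg v) = cnt (insert v V)"
  proof
    fix d
    have *: "int (card {m \<in> ?F d. w m = a}) = cnt V a * geom (deg v) (d - a)" if a: "a \<in> w ` ?F d" for a
    proof -
      obtain m where m: "m \<in> ?F d" "a = w m" using a by blast
      let ?n = "lookup m v"
      have d: "d = a + (\<Sum>i<?n. deg v)" using d_eq[OF m(1)] m(2) by simp
      have "{m \<in> ?F d. w m = a} = (\<lambda>k. k + single v ?n) ` fibre V a"
      proof (intro subset_antisym subsetI)
        fix k assume k: "k \<in> {m \<in> ?F d. w m = a}"
        then have "(\<Sum>i<lookup k v. deg v) = (\<Sum>i<?n. deg v)" using d_eq[of k d] d by auto
        then have "lookup k v = ?n" by (rule multiple_deg_inject)
        then show "k \<in> (\<lambda>k. k + single v ?n) ` fibre V a"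
          using k restr[of k d] by (intro image_eqI[of _ _ "k - single v (lookup k v)"]) auto
      qed (use ext[of _ a ?n] d in auto)
      then have "card {m \<in> ?F d. w m = a} = card (fibre V a)"
        by (simp add: card_image)
      moreover have "geom (deg v) (d - a) = 1" by (auto simp: geom d)
      ultimately show ?thesis by (simp add: cnt_def)
    qed
    have "cnt (insert v V) d = (\<Sum>m\<in>?F d. 1)" by (simp add: cnt_def)
    also have "\<dots> = (\<Sum>a\<in>w ` ?F d. \<Sum>m\<in>{m \<in> ?F d. w m = a}. 1)"
      using finF by (rule sum.image_gen)
    also have "\<dots> = (\<Sum>a\<in>w ` ?F d. cnt V a * geom (deg v) (d - a))"
      using * by (intro sum.cong) auto
    finally show "(cnt V \<star> geom (deg v)) d = cnt (insert v V) d"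
      unfolding series_mult_def A ..
  qed
qed

lemma geom_eq_cnt: "geom (deg v) = cnt {v}"
  using cnt_insert[of "{}" v] by (simp add: cnt_empty zpow_0_mult)

text \<open>The monomials of degree \<open>d\<close> that are not normal are the products of
  \<open>L\<close> with arbitrary monomials of degree \<open>d - mweight deg L\<close>; they account
  for the factor 1 - z^(deg L).\<close>

lemma cnt_normal_monoms:
  assumes V: "finite V" and L: "keys L \<subseteq> V" "L \<noteq> 0"
  shows "int (card {m \<in> normal_monoms V L. mweight deg m = d}) = cnt V d - cnt V (d - mweight deg L)"
proof -
  let ?N = "{m \<in> normal_monoms V L. mweight deg m = d}"
  let ?D = "(\<lambda>m. m + L) ` fibre V (d - mweight deg L)"
  have "fibre V d = ?N \<union> ?D"
  proof (intro subset_antisym subsetI)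
    fix m assume m: "m \<in> fibre V d"
    show "m \<in> ?N \<union> ?D"
    proof (cases "\<forall>v. lookup L v \<le> lookup m v")
      case True
      then have eq: "m = (m - L) + L"
        by (intro poly_mapping_eqI) (simp add: lookup_add lookup_minus)
      have "keys (m - L) \<subseteq> V" using m by (auto simp: fibre_def in_keys_iff lookup_minus)
      then have "m - L \<in> fibre V (d - mweight deg L)"
        using m mweight_add[of deg "m - L" L] eq[symmetric] by (auto simp: fibre_def)
      then show ?thesis using eq by blast
    qed (use m in \<open>auto simp: fibre_def normal_monoms_def\<close>)
  next
    fix m assume "m \<in> ?N \<union> ?D"
    then show "m \<in> fibre V d"
    proof
      assume "m \<in> ?D"
      then obtain k where "m = k + L" "k \<in> fibre V (d - mweight deg L)" by blast
      then show "m \<in> fibre V d"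
        using L(1) keys_add[of k L] by (auto simp: fibre_def mweight_add)
    qed (auto simp: fibre_def normal_monoms_def)
  qed
  moreover have "?N \<inter> ?D = {}" by (auto simp: normal_monoms_def lookup_add)
  moreover have "card ?D = card (fibre V (d - mweight deg L))" by (simp add: card_image)
  moreover have "finite ?D" using finite_fibre[OF V] by simp
  moreover have "finite ?N"
    by (rule finite_subset[OF _ finite_fibre[OF V, of d]]) (auto simp: fibre_def normal_monoms_def)
  ultimately show ?thesis by (simp add: cnt_def card_Un_disjoint)
qed

text \<open>In a normal monomial \<open>v\<close> has exponent 0 or 1. This yields the numerator 1 +
  z^(deg v) directly, with \<open>v\<close> gone from the denominator.\<close>

lemma cnt_normal_monoms_square:
  assumes V: "finite V" "v \<notin> V"
  shows "int (card {m \<in> normal_monoms (insert v V) (single v 2). mweight deg m = d})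
    = cnt V d + cnt V (d - deg v)"
proof -
  let ?N = "{m \<in> normal_monoms (insert v V) (single v 2). mweight deg m = d}"
  let ?D = "(\<lambda>m. m + single v 1) ` fibre V (d - deg v)"
  have deg_v: "mweight deg (single v 1) = deg v" by (simp add: mweight_single)
  have le: "(\<forall>w. lookup (single v 2) w \<le> lookup m w) \<longleftrightarrow> 2 \<le> lookup m v" for m :: "'v \<Rightarrow>\<^sub>0 nat"
    by (auto simp: lookup_single when_def)
  have "?N = fibre V d \<union> ?D"
  proof (intro subset_antisym subsetI)
    fix m assume m: "m \<in> ?N"
    then consider "lookup m v = 0" | "lookup m v = 1" by (fastforce simp: normal_monoms_def le)
    then show "m \<in> fibre V d \<union> ?D"
    proof cases
      case 1
      then have "v \<notin> keys m" by (simp add: in_keys_iff)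
      then show ?thesis using m by (auto simp: normal_monoms_def fibre_def)
    next
      case 2
      then have eq: "m = (m - single v 1) + single v 1"
        by (intro poly_mapping_eqI) (auto simp: lookup_add lookup_minus lookup_single when_def)
      have "keys (m - single v 1) \<subseteq> V"
        using m 2 by (auto simp: normal_monoms_def subset_iff in_keys_iff lookup_minus lookup_single when_def split: if_splits)
      then have "m - single v 1 \<in> fibre V (d - deg v)"
        using m mweight_add[of deg "m - single v 1" "single v 1"] eq[symmetric] deg_v
        by (auto simp: fibre_def algebra_simps)
      then show ?thesis using eq by blast
    qed
  next
    fix m assume "m \<in> fibre V d \<union> ?D"
    then show "m \<in> ?N"
    proof
      assume "m \<in> fibre V d"
      then have "keys m \<subseteq> V" "mweight deg m = d" "lookup m v = 0" using V(2) by (auto simp: fibre_def in_keys_iff)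
      then show ?thesis by (auto simp: normal_monoms_def le)
    next
      assume "m \<in> ?D"
      then obtain k where k: "m = k + single v 1" "keys k \<subseteq> V" "mweight deg k = d - deg v"
        by (auto simp: fibre_def)
      moreover have "lookup k v = 0" using k V(2) by (auto simp: in_keys_iff)
      moreover have "keys m \<subseteq> insert v V" using k keys_add[of k "single v 1"] by auto
      ultimately show ?thesis
        using deg_v by (auto simp: normal_monoms_def le mweight_add lookup_add)
    qed
  qed
  moreover have "lookup m v = 0" if "m \<in> fibre V d" for m
    using that V(2) by (auto simp: fibre_def in_keys_iff)
  then have "fibre V d \<inter> ?D = {}" by (force simp: lookup_add)
  moreover have "card ?D = card (fibre V (d - deg v))" by (simp add: card_image)
  ultimately show ?thesis
    using finite_fibre[OF V(1)] by (simp add: cnt_def card_Un_disjoint)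
qed

end

section \<open>Semi-invariants in coordinates\<close>

definition mat2 :: "'k \<Rightarrow> 'k \<Rightarrow> 'k \<Rightarrow> 'k \<Rightarrow> 'k^2^2" where
  "mat2 a b c d = (\<chi> i j. if i = 1 then (if j = 1 then a else b) else (if j = 1 then c else d))"

definition row2 :: "'k \<Rightarrow> 'k \<Rightarrow> 'k^2^1" where
  "row2 a b = (\<chi> i j. if j = 1 then a else b)"

definition col2 :: "'k \<Rightarrow> 'k \<Rightarrow> 'k^1^2" where
  "col2 a b = (\<chi> i j. if i = 1 then a else b)"

lemma mat2_nth [simp]:
  "mat2 a b c d $ 1 $ 1 = a" "mat2 a b c d $ 1 $ 2 = b" "mat2 a b c d $ 2 $ 1 = c" "mat2 a b c d $ 2 $ 2 = d"
  by (simp_all add: mat2_def)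

lemma row2_nth [simp]: "row2 a b $ i $ 1 = a" "row2 a b $ i $ 2 = b"
  by (simp_all add: row2_def)

lemma col2_nth [simp]: "col2 a b $ 1 $ j = a" "col2 a b $ 2 $ j = b"
  by (simp_all add: col2_def)

lemmas mat_entry_simps = matrix_matrix_mult_def sum_1 sum_2 vec_eq_iff forall_1 forall_2 mat_def

section \<open>Matrix inverses over a field\<close>

lemma matrix_inv_unique:
  fixes A :: "'k::field^'n^'n"
  assumes "A ** B = mat 1" "B ** A = mat 1"
  shows "matrix_inv A = B"
proof -
  have "A ** matrix_inv A = mat 1 \<and> matrix_inv A ** A = mat 1"
    unfolding matrix_inv_def by (rule someI[of _ B]) (use assms in simp)
  then show ?thesis by (metis assms(1) matrix_mul_assoc matrix_mul_lid matrix_mul_rid)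
qed

lemma matrix_inv_right:
  fixes A :: "'k::field^'n^'n"
  assumes "invertible A"
  shows "A ** matrix_inv A = mat 1"
  using assms matrix_inv_unique unfolding invertible_def by metis

lemma det_matrix_inv:
  fixes A :: "'k::field^'n^'n"
  assumes "invertible A"
  shows "det (matrix_inv A) = inverse (det A)"
proof -
  have "det A * det (matrix_inv A) = 1"
    using matrix_inv_right[OF assms] by (metis det_I det_mul)
  then show ?thesis by (simp add: inverse_unique)
qed

lemma matrix_inv_mat2:
  fixes a :: "'k::field"
  assumes "a * d - b * c = 1"
  shows "matrix_inv (mat2 a b c d) = mat2 d (- b) (- c) a"
  by (rule matrix_inv_unique) (use assms in \<open>auto simp: mat_entry_simps algebra_simps\<close>)

lemma cancel_matrix_inv:
  fixes g :: "'k::field^'n^'n"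
  assumes "invertible g"
  shows "X ** g ** (matrix_inv g ** Y ** Z) = X ** Y ** Z"
proof -
  have "X ** g ** (matrix_inv g ** Y ** Z) = X ** (g ** matrix_inv g) ** Y ** Z"
    by (simp only: matrix_mul_assoc)
  then show ?thesis by (simp add: matrix_inv_right[OF assms] matrix_mul_rid)
qed

lemma matrix_add_rdistrib: "(A + B) ** C = A ** C + B ** C"
  for C :: "'k::comm_ring_1^'n^'m"
  by (simp add: matrix_matrix_mult_def vec_eq_iff distrib_right sum.distrib)

text \<open>The coefficient of s t in det(s A1 + t A2).\<close>

definition polar_det :: "'k::field rep \<Rightarrow> 'k" where
  "polar_det M = A1 M $ 1 $ 1 * A2 M $ 2 $ 2 + A1 M $ 2 $ 2 * A2 M $ 1 $ 1
     - A1 M $ 1 $ 2 * A2 M $ 2 $ 1 - A1 M $ 2 $ 1 * A2 M $ 1 $ 2"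

text \<open>In this form the behaviour under base change follows from the multiplicativity of
  \<open>det\<close>.\<close>

lemma polar_det_eq: "polar_det M = det (A1 M + A2 M) - x5 M - x6 M"
  by (simp add: polar_det_def x5_def x6_def det_2 algebra_simps)

section \<open>The generators in coordinates and the relations among them\<close>

lemma x1_eq: "x1 M = Bm M $ 1 $ 1 * (A1 M $ 1 $ 1 * Bp M $ 1 $ 1 + A1 M $ 1 $ 2 * Bp M $ 2 $ 1)
    + Bm M $ 1 $ 2 * (A1 M $ 2 $ 1 * Bp M $ 1 $ 1 + A1 M $ 2 $ 2 * Bp M $ 2 $ 1)"
  by (simp add: x1_def det_1 mat_entry_simps algebra_simps)

lemma x2_eq: "x2 M = Bm M $ 1 $ 1 * (A2 M $ 1 $ 1 * Bp M $ 1 $ 1 + A2 M $ 1 $ 2 * Bp M $ 2 $ 1)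
    + Bm M $ 1 $ 2 * (A2 M $ 2 $ 1 * Bp M $ 1 $ 1 + A2 M $ 2 $ 2 * Bp M $ 2 $ 1)"
  by (simp add: x2_def det_1 mat_entry_simps algebra_simps)

lemma x3_eq: "x3 M =
    (A1 M $ 1 $ 1 * Bp M $ 1 $ 1 + A1 M $ 1 $ 2 * Bp M $ 2 $ 1) * (A2 M $ 2 $ 1 * Bp M $ 1 $ 1 + A2 M $ 2 $ 2 * Bp M $ 2 $ 1)
    - (A2 M $ 1 $ 1 * Bp M $ 1 $ 1 + A2 M $ 1 $ 2 * Bp M $ 2 $ 1) * (A1 M $ 2 $ 1 * Bp M $ 1 $ 1 + A1 M $ 2 $ 2 * Bp M $ 2 $ 1)"
  by (simp add: x3_def det_2 matrix_matrix_mult_def sum_1 sum_2)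

lemma x4_eq: "x4 M =
    (Bm M $ 1 $ 1 * A1 M $ 1 $ 1 + Bm M $ 1 $ 2 * A1 M $ 2 $ 1) * (Bm M $ 1 $ 1 * A2 M $ 1 $ 2 + Bm M $ 1 $ 2 * A2 M $ 2 $ 2)
    - (Bm M $ 1 $ 1 * A1 M $ 1 $ 2 + Bm M $ 1 $ 2 * A1 M $ 2 $ 2) * (Bm M $ 1 $ 1 * A2 M $ 1 $ 1 + Bm M $ 1 $ 2 * A2 M $ 2 $ 1)"
  by (simp add: x4_def det_2 matrix_matrix_mult_def sum_1 sum_2)

lemma x5_eq: "x5 M = A1 M $ 1 $ 1 * A1 M $ 2 $ 2 - A1 M $ 1 $ 2 * A1 M $ 2 $ 1"
  by (simp add: x5_def det_2)

lemma x6_eq: "x6 M = A2 M $ 1 $ 1 * A2 M $ 2 $ 2 - A2 M $ 1 $ 2 * A2 M $ 2 $ 1"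
  by (simp add: x6_def det_2)

lemmas x_eqs = x1_eq x2_eq x3_eq x4_eq x5_eq x6_eq polar_det_def

lemma coordinate_poly_funs:
  "(\<lambda>M. Bm M $ i $ j) \<in> poly_funs" "(\<lambda>M. A1 M $ r $ s) \<in> poly_funs"
  "(\<lambda>M. A2 M $ r $ s) \<in> poly_funs" "(\<lambda>M. Bp M $ k $ l) \<in> poly_funs"
  unfolding poly_funs_def by (auto intro!: alg_gen.gen simp: coord_funs_def)

lemmas poly_funs_intros = alg_gen_intros[where X = coord_funs, folded poly_funs_def]

lemma poly_funs_x:
  "x1 \<in> poly_funs" "x2 \<in> poly_funs" "x3 \<in> poly_funs" "x4 \<in> poly_funs" "x5 \<in> poly_funs" "x6 \<in> poly_funs"
  "polar_det \<in> poly_funs"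
  unfolding x_eqs[abs_def] by (intro poly_funs_intros coordinate_poly_funs)+

text \<open>This computes \<open>det N\<close> for \<open>N = x\<^sub>2 A\<^sub>1 - x\<^sub>1 A\<^sub>2\<close> in two ways: up to sign, \<open>B\<^sub>-\<^sub>1 N\<close> is \<open>x\<^sub>4\<close> times
  the annihilator of \<open>B\<^sub>1\<close> and \<open>N B\<^sub>1\<close> is \<open>x\<^sub>3\<close> times the annihilator of \<open>B\<^sub>-\<^sub>1\<close>, so \<open>det N = - x\<^sub>3 x\<^sub>4\<close>.\<close>

lemma semi_invariant_relation:
  "polar_det M * (x1 M * x2 M) = (x2 M)\<^sup>2 * x5 M + (x1 M)\<^sup>2 * x6 M + x3 M * x4 M"
  unfolding x_eqs power2_eq_square by (simp only: ring_distribs) (simp add: algebra_simps)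

lemma x12_nonzero: "\<exists>N. x1 N * x2 N \<noteq> (0 :: 'k::field)"
  by (rule exI[of _ "Rep (row2 1 0) (mat2 1 0 0 0) (mat2 1 0 0 0) (col2 1 0)"]) (simp add: x1_eq x2_eq)

lemma x2o_eq: "x2o = (polar_det :: 'k::field_char_0 rep \<Rightarrow> 'k)"
proof -
  obtain N :: "'k rep" where "x1 N * x2 N \<noteq> 0"
    using x12_nonzero by blast
  then show ?thesis
    unfolding x2o_def
    by (intro quot_eqI semi_invariant_relation poly_funs_x poly_funs_intros)
qed

text \<open>By the relation, the quotient by \<open>x2\<close> in the definition of
  \<open>w1\<close> is x1 D - x2 x5; subtracting x2 x5 once more gives the factor 2.\<close>

lemma w1_eq: "w1 M = x1 M * x2o M - 2 * x2 M * (x5 M :: 'k::field_char_0)"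
proof -
  have "quot (\<lambda>M. x3 M * x4 M + (x1 M)\<^sup>2 * x6 M) x2 = (\<lambda>M. x1 M * polar_det M - x2 M * (x5 M :: 'k))"
  proof -
    obtain N :: "'k rep" where "x2 N \<noteq> 0" using x12_nonzero by fastforce
    moreover have "(x1 M * polar_det M - x2 M * x5 M) * x2 M = x3 M * x4 M + (x1 M)\<^sup>2 * x6 M" for M :: "'k rep"
      using semi_invariant_relation[of M] by (simp add: algebra_simps power2_eq_square)
    ultimately show ?thesis
      by (intro quot_eqI poly_funs_x poly_funs_intros)
  qed
  then show ?thesis by (simp add: w1_def x2o_eq algebra_simps)
qed

lemma w2_eq: "w2 M = (x2o M)\<^sup>2 - 4 * x5 M * x6 M"
  by (simp add: w2_def)

text \<open>Completing the square: 4 a q(s, t) = (2 a s + b t)^2 - (b^2 - 4 a c) t^2 for the form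
  q(s, t) = det(s A1 + t A2), with a = x5, b = D, c = x6, at (s, t) = (x2, - x1), where q takes the
  value - x3 x4.\<close>

lemma U_relation:
  "(w1 M)\<^sup>2 + 4 * x3 M * x4 M * x5 M - w2 M * (x1 M)\<^sup>2 = (0 :: 'k::field_char_0)"
proof -
  have "(w1 M)\<^sup>2 - w2 M * (x1 M)\<^sup>2 = 4 * x5 M * ((x2 M)\<^sup>2 * x5 M + (x1 M)\<^sup>2 * x6 M - polar_det M * (x1 M * x2 M))"
    by (simp add: w1_eq w2_eq x2o_eq power2_eq_square algebra_simps)
  also have "\<dots> = - (4 * x3 M * x4 M * x5 M)"
    unfolding semi_invariant_relation by (simp add: algebra_simps)
  finally show ?thesis by (simp add: algebra_simps)
qed

section \<open>Weights of the generators\<close>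

lemma has_weightI:
  fixes f :: "'k::field rep \<Rightarrow> 'k"
  assumes "\<And>g M. is_GL g \<Longrightarrow> f (base_change g M) = wchar d (Inl g) * f M"
    "\<And>t1 t2 M. t1 \<noteq> 0 \<Longrightarrow> t2 \<noteq> 0 \<Longrightarrow> f (torus_act t1 t2 M) = wchar d (Inr (t1, t2)) * f M"
  shows "has_weight d f"
  unfolding has_weight_iff
proof (intro allI impI)
  fix h :: "'k gl + 'k \<times> 'k" and M :: "'k rep" assume "wdom h"
  then show "f (wact h M) = wchar d h * f M"
    using assms by (cases h rule: wdom.cases) auto
qed

lemma torus_act_nth [simp]:
  "Bm (torus_act t1 t2 M) = Bm M" "Bp (torus_act t1 t2 M) = Bp M"
  "A1 (torus_act t1 t2 M) $ i $ j = t1 * A1 M $ i $ j" "A2 (torus_act t1 t2 M) $ i $ j = t2 * A2 M $ i $ j"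
  by (simp_all add: torus_act_def smult_mat_def)

lemma U_act_nth [simp]:
  "Bm (U_act u M) = Bm M" "Bp (U_act u M) = Bp M"
  "A1 (U_act u M) = A1 M" "A2 (U_act u M) $ i $ j = A2 M $ i $ j + u * A1 M $ i $ j"
  by (simp_all add: U_act_def smult_mat_def)

lemmas det_base_change = det_mul det_matrix_inv power_int_minus divide_inverse

lemma has_weight_x1: "has_weight d1 (x1 :: 'k::field_char_0 rep \<Rightarrow> 'k)"
proof (rule has_weightI)
  fix g :: "'k gl" and M assume g: "is_GL g"
  have "Bm (base_change g M) ** A1 (base_change g M) ** Bp (base_change g M)
      = matrix_inv (g_m1 g) ** (Bm M ** A1 M ** Bp M) ** g_p1 g"
    using g by (simp add: base_change_def is_GL_def cancel_matrix_inv) (simp add: matrix_mul_assoc)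
  then show "x1 (base_change g M) = wchar d1 (Inl g) * x1 M"
    using g by (simp add: x1_def d1_def is_GL_def det_base_change)
qed (simp add: x1_eq d1_def algebra_simps)

lemma has_weight_x2: "has_weight d2 (x2 :: 'k::field_char_0 rep \<Rightarrow> 'k)"
proof (rule has_weightI)
  fix g :: "'k gl" and M assume g: "is_GL g"
  have "Bm (base_change g M) ** A2 (base_change g M) ** Bp (base_change g M)
      = matrix_inv (g_m1 g) ** (Bm M ** A2 M ** Bp M) ** g_p1 g"
    using g by (simp add: base_change_def is_GL_def cancel_matrix_inv) (simp add: matrix_mul_assoc)
  then show "x2 (base_change g M) = wchar d2 (Inl g) * x2 M"
    using g by (simp add: x2_def d2_def is_GL_def det_base_change)
qed (simp add: x2_eq d2_def algebra_simps)

text \<open>\<open>G\<close> acts on both columns at once, while the 1 x 1 matrix \<open>s\<close>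
  scales each of them; hence the square.\<close>

lemma det_columns:
  fixes G :: "'k::field^2^2" and P Q :: "'k^1^2" and s :: "'k^1^1"
  shows "det (\<chi> i (j::2). if j = 1 then (G ** P ** s) $ i $ 1 else (G ** Q ** s) $ i $ 1)
    = det G * (det s)\<^sup>2 * det (\<chi> i (j::2). if j = 1 then P $ i $ 1 else Q $ i $ 1)"
  by (simp add: det_2 det_1 mat_entry_simps algebra_simps power2_eq_square)

lemma det_rows:
  fixes G :: "'k::field^2^2" and P Q :: "'k^2^1" and s :: "'k^1^1"
  shows "det (\<chi> (i::2) j. if i = 1 then (s ** P ** G) $ 1 $ j else (s ** Q ** G) $ 1 $ j)
    = (det s)\<^sup>2 * det G * det (\<chi> (i::2) j. if i = 1 then P $ 1 $ j else Q $ 1 $ j)"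
  by (simp add: det_2 det_1 mat_entry_simps algebra_simps power2_eq_square)

lemma has_weight_x3: "has_weight d3 (x3 :: 'k::field_char_0 rep \<Rightarrow> 'k)"
proof (rule has_weightI)
  fix g :: "'k gl" and M assume g: "is_GL g"
  have eq: "A1 (base_change g M) ** Bp (base_change g M) = matrix_inv (g_m2 g) ** (A1 M ** Bp M) ** g_p1 g"
    "A2 (base_change g M) ** Bp (base_change g M) = matrix_inv (g_m2 g) ** (A2 M ** Bp M) ** g_p1 g"
    using g by (simp_all add: base_change_def is_GL_def cancel_matrix_inv) (simp_all add: matrix_mul_assoc)
  show "x3 (base_change g M) = wchar d3 (Inl g) * x3 M"
    unfolding x3_def eq det_columns using g by (simp add: d3_def is_GL_def det_base_change)
qed (simp add: x3_eq d3_def algebra_simps)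

lemma has_weight_x4: "has_weight d4 (x4 :: 'k::field_char_0 rep \<Rightarrow> 'k)"
proof (rule has_weightI)
  fix g :: "'k gl" and M assume g: "is_GL g"
  have eq: "Bm (base_change g M) ** A1 (base_change g M) = matrix_inv (g_m1 g) ** (Bm M ** A1 M) ** g_p2 g"
    "Bm (base_change g M) ** A2 (base_change g M) = matrix_inv (g_m1 g) ** (Bm M ** A2 M) ** g_p2 g"
    using g by (simp_all add: base_change_def is_GL_def cancel_matrix_inv) (simp_all add: matrix_mul_assoc)
  show "x4 (base_change g M) = wchar d4 (Inl g) * x4 M"
    unfolding x4_def eq det_rows using g by (simp add: d4_def is_GL_def det_base_change power_inverse)
qed (simp add: x4_eq d4_def algebra_simps)

lemma has_weight_x5: "has_weight d5 (x5 :: 'k::field_char_0 rep \<Rightarrow> 'k)"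
proof (rule has_weightI)
  fix g :: "'k gl" and M assume "is_GL g"
  then show "x5 (base_change g M) = wchar d5 (Inl g) * x5 M"
    by (simp add: x5_def base_change_def d5_def is_GL_def det_base_change)
qed (simp add: x5_eq d5_def algebra_simps power2_eq_square)

lemma has_weight_x6: "has_weight d6 (x6 :: 'k::field_char_0 rep \<Rightarrow> 'k)"
proof (rule has_weightI)
  fix g :: "'k gl" and M assume "is_GL g"
  then show "x6 (base_change g M) = wchar d6 (Inl g) * x6 M"
    by (simp add: x6_def base_change_def d6_def is_GL_def det_base_change)
qed (simp add: x6_eq d6_def algebra_simps power2_eq_square)

lemma has_weight_x2o: "has_weight d2o (x2o :: 'k::field_char_0 rep \<Rightarrow> 'k)"
proof (rule has_weightI)
  have d2o: "d2o = ((-1, 0, 0, 1), (1, 1))"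
    by (simp add: d2o_def d1_def d2_def d6_def plus_prod_def minus_prod_def)
  fix g :: "'k gl" and M assume g: "is_GL g"
  let ?G = "matrix_inv (g_m2 g)" and ?H = "g_p2 g"
  have "A1 (base_change g M) + A2 (base_change g M) = ?G ** (A1 M + A2 M) ** ?H"
    by (simp add: base_change_def matrix_add_ldistrib matrix_add_rdistrib)
  then show "x2o (base_change g M) = wchar d2o (Inl g) * x2o M"
    using g by (simp add: x2o_eq polar_det_eq x5_def x6_def base_change_def d2o is_GL_def
        det_base_change algebra_simps)
next
  have d2o: "d2o = ((-1, 0, 0, 1), (1, 1))"
    by (simp add: d2o_def d1_def d2_def d6_def plus_prod_def minus_prod_def)
  fix t1 t2 :: 'k and M
  show "x2o (torus_act t1 t2 M) = wchar d2o (Inr (t1, t2)) * x2o M"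
    by (simp add: x2o_eq polar_det_def d2o algebra_simps)
qed

lemma has_weight_w1: "has_weight d2' (w1 :: 'k::field_char_0 rep \<Rightarrow> 'k)"
proof -
  have d: "d1 + d2o = d2'" "d2 + d5 = d2'"
    by (simp_all add: d2'_def d2o_def d1_def d2_def d6_def d5_def plus_prod_def minus_prod_def)
  have "has_weight d2' (\<lambda>M :: 'k rep. x1 M * x2o M - 2 * (x2 M * x5 M))"
    using has_weight_mult[OF has_weight_x1 has_weight_x2o] has_weight_mult[OF has_weight_x2 has_weight_x5]
    unfolding d by (intro has_weight_diff has_weight_scale)
  then show ?thesis unfolding w1_eq[abs_def] by (simp add: mult.assoc)
qed

lemma has_weight_w2: "has_weight (d2o + d2o) (w2 :: 'k::field_char_0 rep \<Rightarrow> 'k)"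
proof -
  have d: "d5 + d6 = d2o + d2o"
    by (simp add: d2o_def d1_def d2_def d6_def d5_def plus_prod_def minus_prod_def)
  have "has_weight (d2o + d2o) (\<lambda>M :: 'k rep. x2o M * x2o M - 4 * (x5 M * x6 M))"
    using has_weight_mult[OF has_weight_x2o has_weight_x2o] has_weight_mult[OF has_weight_x5 has_weight_x6]
    unfolding d by (intro has_weight_diff has_weight_scale)
  then show ?thesis unfolding w2_eq[abs_def] by (simp add: mult.assoc power2_eq_square)
qed

lemma has_weight_elem: "has_weight (vdeg v) (elem v :: 'k::field_char_0 rep \<Rightarrow> 'k)"
  by (cases v) (simp_all only: elem.simps vdeg.simps has_weight_x1 has_weight_x2 has_weight_x3
      has_weight_x4 has_weight_x5 has_weight_x6 has_weight_x2o has_weight_w1 has_weight_w2)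

section \<open>Membership of the generators in the rings of invariants\<close>

lemma poly_funs_elem: "elem v \<in> (poly_funs :: ('k::field_char_0 rep \<Rightarrow> 'k) set)"
proof -
  have "x2o \<in> (poly_funs :: ('k rep \<Rightarrow> 'k) set)" unfolding x2o_eq by (rule poly_funs_x)
  moreover from this have "w1 \<in> (poly_funs :: ('k rep \<Rightarrow> 'k) set)" "w2 \<in> (poly_funs :: ('k rep \<Rightarrow> 'k) set)"
    unfolding w1_eq[abs_def] w2_eq[abs_def] by (intro poly_funs_intros poly_funs_x, simp?)+
  ultimately show ?thesis by (cases v) (simp_all add: poly_funs_x)
qed

lemma SI_elem: "elem v \<in> (SI :: ('k::field_char_0 rep \<Rightarrow> 'k) set)"
proof -
  obtain a1 a2 a3 a4 a5 a6 where d: "vdeg v = ((a1, a2, a3, a4), (a5, a6))" by (metis surj_pair)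
  have w: "has_weight (vdeg v) (elem v :: 'k rep \<Rightarrow> 'k)" by (rule has_weight_elem)
  have "elem v (base_change g M) = elem v M" if "is_SL g" for g :: "'k gl" and M
  proof -
    have "is_GL g" using that by (simp add: is_SL_def is_GL_def invertible_det_nz)
    then show ?thesis using w that by (simp add: d is_SL_def)
  qed
  then show ?thesis by (simp add: SI_def poly_funs_elem)
qed

lemma SI_subalgebra: "X \<subseteq> SI \<Longrightarrow> alg_gen X \<subseteq> SI"
proof
  fix f assume X: "X \<subseteq> SI" and "f \<in> alg_gen X"
  from this(2) show "f \<in> SI"
    by induction (use X in \<open>auto simp: SI_def intro: poly_funs_intros\<close>)
qed

lemma SI_U_subalgebra: "X \<subseteq> SI_U \<Longrightarrow> alg_gen X \<subseteq> SI_U"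
proof
  fix f assume X: "X \<subseteq> SI_U" and f: "f \<in> alg_gen X"
  have "f (U_act u M) = f M" for u M
    using f by induction (use X in \<open>auto simp: SI_U_def\<close>)
  moreover have "f \<in> SI" using SI_subalgebra[of X] X f by (auto simp: SI_U_def)
  ultimately show "f \<in> SI_U" by (simp add: SI_U_def)
qed

text \<open>\<open>U\<close> replaces s by s + u t in det(s A1 + t A2), which explains the new
  values of \<open>x5\<close>, \<open>polar_det\<close> and \<open>x6\<close>, the coefficients of
  this form.\<close>

lemma U_act_x:
  "x1 (U_act u M) = x1 M" "x2 (U_act u M) = x2 M + u * x1 M" "x3 (U_act u M) = x3 M"
  "x4 (U_act u M) = x4 M" "x5 (U_act u M) = x5 M" "x6 (U_act u M) = x6 M + u * polar_det M + u\<^sup>2 * x5 M"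
  "polar_det (U_act u M) = polar_det M + 2 * u * x5 M"
  by (simp_all add: x_eqs algebra_simps power2_eq_square)

lemma SI_U_elem:
  assumes "v \<in> {W1, W2, X1, X3, X4, X5}"
  shows "elem v \<in> (SI_U :: ('k::field_char_0 rep \<Rightarrow> 'k) set)"
proof -
  have "w1 (U_act u M) = w1 M" "w2 (U_act u M) = w2 M" for u and M :: "'k rep"
    by (simp_all add: w1_eq w2_eq x2o_eq U_act_x algebra_simps power2_eq_square)
  then show ?thesis
    using assms SI_elem[of v, where 'k = 'k] unfolding SI_U_def by (auto simp: U_act_x)
qed

section \<open>A section over the open set where x1 does not vanish\<close>

text \<open>With both vectors equal to (1, 0) and A1 diagonal, all entries are forced:
  \<open>x1\<close> and \<open>x5\<close> determine A1, and \<open>x2\<close>, \<open>x4\<close>,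
  \<open>x3\<close>, \<open>polar_det\<close> determine one entry of A2 each.\<close>

definition section_rep :: "'k::field rep \<Rightarrow> 'k rep" where
  "section_rep M = Rep (row2 1 0) (mat2 (x1 M) 0 0 (x5 M / x1 M))
     (mat2 (x2 M) (x4 M / x1 M) (x3 M / x1 M) ((polar_det M - x5 M * x2 M / x1 M) / x1 M)) (col2 1 0)"

lemma row2_cases: obtains a b where "(B :: 'k^2^1) = row2 a b"
  using that[of "B $ 1 $ 1" "B $ 1 $ 2"] by (simp add: vec_eq_iff forall_1 forall_2)

lemma col2_cases: obtains a b where "(B :: 'k^1^2) = col2 a b"
  using that[of "B $ 1 $ 1" "B $ 2 $ 1"] by (simp add: vec_eq_iff forall_1 forall_2)

lemma mat2_cases: obtains a b c d where "(B :: 'k^2^2) = mat2 a b c d"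
  using that[of "B $ 1 $ 1" "B $ 1 $ 2" "B $ 2 $ 1" "B $ 2 $ 2"] by (simp add: vec_eq_iff forall_2)

lemma row2_mult_mat2: "row2 a b ** mat2 c d e f = row2 (a * c + b * e) (a * d + b * f :: 'k::comm_ring_1)"
  by (simp add: mat_entry_simps)

lemma mat2_mult_col2: "mat2 c d e f ** col2 a b = col2 (c * a + d * b) (e * a + f * b :: 'k::comm_ring_1)"
  by (simp add: mat_entry_simps)

lemma mat2_mult_mat2: "mat2 a b c d ** mat2 a' b' c' d'
    = mat2 (a * a' + b * c') (a * b' + b * d') (c * a' + d * c') (c * b' + d * d' :: 'k::comm_ring_1)"
  by (simp add: mat_entry_simps)

lemma section_rep_orbit:
  fixes M :: "'k::field rep"
  assumes "x1 M \<noteq> 0"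
  shows "\<exists>g. is_SL g \<and> base_change g M = section_rep M"
proof -
  obtain B A A' C where M0: "M = Rep B A A' C" by (cases M)
  obtain b1 b2 where B: "B = row2 b1 b2" by (rule row2_cases)
  obtain a11 a12 a21 a22 where A: "A = mat2 a11 a12 a21 a22" by (rule mat2_cases)
  obtain e11 e12 e21 e22 where A': "A' = mat2 e11 e12 e21 e22" by (rule mat2_cases)
  obtain c1 c2 where C: "C = col2 c1 c2" by (rule col2_cases)
  note M = M0[unfolded B A A' C]
  \<comment> \<open>\<open>p\<close> is the row \<open>Bm M ** A1 M\<close> and \<open>q\<close> the
    column \<open>A1 M ** Bp M\<close>; paired with \<open>Bp M\<close> and \<open>Bm M\<close>
    respectively, both give \<open>X\<close>.\<close>
  define p1 where "p1 = b1 * a11 + b2 * a21"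
  define p2 where "p2 = b1 * a12 + b2 * a22"
  define q1 where "q1 = a11 * c1 + a12 * c2"
  define q2 where "q2 = a21 * c1 + a22 * c2"
  define X where "X = x1 M"
  have X: "X \<noteq> 0" using assms by (simp add: X_def)
  have Xp: "X = p1 * c1 + p2 * c2" and Xq: "X = b1 * q1 + b2 * q2"
    by (simp_all add: X_def M x1_eq p1_def p2_def q1_def q2_def algebra_simps)
  note pq = p1_def p2_def q1_def q2_def
  \<comment> \<open>The first row of \<open>?Gi\<close> is (b1, b2) and its second row annihilates
    q; the first column of \<open>?H\<close> is (c1, c2) and its second column is annihilated by p.
    This makes A1 diagonal, and the divisions by \<open>X\<close> make both determinants 1.\<close>
  let ?Gi = "mat2 b1 b2 (- q2 / X) (q1 / X)" and ?G = "mat2 (q1 / X) (- b2) (q2 / X) b1"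
  let ?Hi = "mat2 (p1 / X) (p2 / X) (- c2) c1" and ?H = "mat2 c1 (- p2 / X) c2 (p1 / X)"
  have detG: "q1 / X * b1 - - b2 * (q2 / X) = 1" and detH: "c1 * (p1 / X) - - p2 / X * c2 = 1"
  proof -
    have "q1 / X * b1 - - b2 * (q2 / X) = (b1 * q1 + b2 * q2) / X"
      "c1 * (p1 / X) - - p2 / X * c2 = (p1 * c1 + p2 * c2) / X"
      by (simp_all add: add_divide_distrib mult.commute)
    then show "q1 / X * b1 - - b2 * (q2 / X) = 1" "c1 * (p1 / X) - - p2 / X * c2 = 1"
      unfolding Xp[symmetric] Xq[symmetric] using X by simp_all
  qed
  have G: "matrix_inv ?G = ?Gi" and H: "matrix_inv ?H = ?Hi"
    using matrix_inv_mat2[OF detG] matrix_inv_mat2[OF detH] by simp_all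
  have 1: "matrix_inv (mat 1 :: 'k^1^1) = mat 1" by (rule matrix_inv_unique) simp_all
  let ?g = "GL ?G (mat 1) (mat 1) ?H"
  have SL: "is_SL ?g" using detG detH by (simp add: is_SL_def det_2)
  have Bm': "row2 b1 b2 ** ?G = row2 1 0"
    using detG unfolding row2_mult_mat2 by (simp add: mult.commute add.commute)
  have Bp': "?Hi ** col2 c1 c2 = col2 1 0"
    using detH unfolding mat2_mult_col2 by (simp add: mult.commute add.commute)
  \<comment> \<open>One formula with an arbitrary middle matrix serves both A1 and A2.\<close>
  have "?Gi ** mat2 s t u v ** ?H = mat2
       (b1 * (s * c1 + t * c2) + b2 * (u * c1 + v * c2))
       ((p1 * (b1 * t + b2 * v) - p2 * (b1 * s + b2 * u)) / X)
       ((q1 * (u * c1 + v * c2) - q2 * (s * c1 + t * c2)) / X)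
       ((q2 * s * p2 - q2 * t * p1 - q1 * u * p2 + q1 * v * p1) / X\<^sup>2)" for s t u v
    using X unfolding mat2_mult_mat2 by (simp add: vec_eq_iff forall_2 field_simps power2_eq_square)
  note * = this[of a11 a12 a21 a22] this[of e11 e12 e21 e22]
  have A1': "?Gi ** A ** ?H = mat2 X 0 0 (x5 M / X)"
  proof -
    have "q2 * a11 * p2 - q2 * a12 * p1 - q1 * a21 * p2 + q1 * a22 * p1 = X * x5 M"
      unfolding Xp x5_eq M pq by (simp add: algebra_simps)
    moreover have "p1 * (b1 * a12 + b2 * a22) - p2 * (b1 * a11 + b2 * a21) = 0"
      "q1 * (a21 * c1 + a22 * c2) - q2 * (a11 * c1 + a12 * c2) = 0"
      "b1 * (a11 * c1 + a12 * c2) + b2 * (a21 * c1 + a22 * c2) = X"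
      unfolding Xp pq by (simp_all add: algebra_simps)
    ultimately show ?thesis using X unfolding A * by (simp add: power2_eq_square)
  qed
  have A2': "?Gi ** A' ** ?H = mat2 (x2 M) (x4 M / X) (x3 M / X) ((polar_det M - x5 M * x2 M / X) / X)"
  proof -
    have eq1: "q2 * e11 * p2 - q2 * e12 * p1 - q1 * e21 * p2 + q1 * e22 * p1 = X * polar_det M - x5 M * x2 M"
      unfolding Xp x5_eq x2_eq polar_det_def M pq by (simp add: algebra_simps)
    have eq2: "p1 * (b1 * e12 + b2 * e22) - p2 * (b1 * e11 + b2 * e21) = x4 M"
      "q1 * (e21 * c1 + e22 * c2) - q2 * (e11 * c1 + e12 * c2) = x3 M"
      "b1 * (e11 * c1 + e12 * c2) + b2 * (e21 * c1 + e22 * c2) = x2 M"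
      unfolding x_eqs M pq by (simp_all add: algebra_simps)
    show ?thesis
      unfolding A' * eq1 eq2 using X by (simp add: diff_divide_distrib power2_eq_square)
  qed
  have "Bm M = row2 b1 b2" "A1 M = A" "A2 M = A'" "Bp M = col2 c1 c2" by (simp_all add: M0 B C)
  then have "base_change ?g M = section_rep M"
    unfolding base_change_def section_rep_def X_def[symmetric]
    by (simp only: gl.sel G H 1 matrix_mul_lid matrix_mul_rid Bm' Bp' A1' A2')
  then show ?thesis using SL by blast
qed

text \<open>Substituting fractions with powers of \<open>y\<close> as denominators into a polynomial
  gives such a fraction again. The identity is asked for only where \<open>y M\<close> is nonzero,
  since elsewhere a division by zero would return 0.\<close>

lemma section_numerator:
  fixes s :: "'k::field rep \<Rightarrow> 'k rep"
  assumes coord: "\<And>c. c \<in> coord_funs \<Longrightarrow> \<exists>N. \<exists>h\<in>alg_gen X. \<forall>M. y M \<noteq> 0 \<longrightarrow> c (s M) * y M ^ N = h M"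
    and y: "y \<in> alg_gen X" and f: "f \<in> poly_funs"
  shows "\<exists>N. \<exists>h\<in>alg_gen X. \<forall>M. y M \<noteq> 0 \<longrightarrow> f (s M) * y M ^ N = h M"
  using f unfolding poly_funs_def
proof induction
  case (const c)
  show ?case by (rule exI[of _ 0], rule bexI[of _ "\<lambda>_. c"]) (auto intro: alg_gen.const)
next
  case (gen f)
  then show ?case by (rule coord)
next
  case (add f g)
  then obtain N h N' h' where h: "h \<in> alg_gen X" "\<And>M. y M \<noteq> 0 \<Longrightarrow> f (s M) * y M ^ N = h M"
    "h' \<in> alg_gen X" "\<And>M. y M \<noteq> 0 \<Longrightarrow> g (s M) * y M ^ N' = h' M" by blast
  have "(f (s M) + g (s M)) * y M ^ (N + N') = h M * y M ^ N' + h' M * y M ^ N" if "y M \<noteq> 0" for M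
    unfolding h(2)[OF that, symmetric] h(4)[OF that, symmetric] by (simp add: power_add algebra_simps)
  moreover have "(\<lambda>M. h M * y M ^ N' + h' M * y M ^ N) \<in> alg_gen X"
    using h y by (intro alg_gen_intros)
  ultimately show ?case
    by (intro exI[of _ "N + N'"] bexI[of _ "\<lambda>M. h M * y M ^ N' + h' M * y M ^ N"]) auto
next
  case (mult f g)
  then obtain N h N' h' where h: "h \<in> alg_gen X" "\<And>M. y M \<noteq> 0 \<Longrightarrow> f (s M) * y M ^ N = h M"
    "h' \<in> alg_gen X" "\<And>M. y M \<noteq> 0 \<Longrightarrow> g (s M) * y M ^ N' = h' M" by blast
  have "(f (s M) * g (s M)) * y M ^ (N + N') = h M * h' M" if "y M \<noteq> 0" for M
    unfolding h(2)[OF that, symmetric] h(4)[OF that, symmetric] by (simp add: power_add algebra_simps)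
  moreover have "(\<lambda>M. h M * h' M) \<in> alg_gen X" using h by (intro alg_gen_intros)
  ultimately show ?case
    by (intro exI[of _ "N + N'"] bexI[of _ "\<lambda>M. h M * h' M"]) auto
qed

text \<open>The common shape of the sections used for \<open>SI\<close> and \<open>SI_U\<close>,
  which differ only in \<open>u2\<close> and \<open>u5\<close>.\<close>

lemma section_numerator_Rep:
  fixes y :: "'k::field rep \<Rightarrow> 'k"
  assumes "y \<in> alg_gen X" "f \<in> poly_funs"
    and "u1 \<in> alg_gen X" "u2 \<in> alg_gen X" "u3 \<in> alg_gen X" "u4 \<in> alg_gen X" "u5 \<in> alg_gen X"
    and s: "\<And>M. s M = Rep (row2 1 0) (mat2 (y M) 0 0 (u1 M / y M))
      (mat2 (u2 M) (u3 M / y M) (u4 M / y M) (u5 M / (y M)\<^sup>2)) (col2 1 0)"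
  shows "\<exists>N. \<exists>h\<in>alg_gen X. \<forall>M. y M \<noteq> 0 \<longrightarrow> f (s M) * y M ^ N = h M"
proof (rule section_numerator[OF _ assms(1,2)])
  fix c :: "'k rep \<Rightarrow> 'k" assume c: "c \<in> coord_funs"
  have c0: "(\<lambda>_. 0) \<in> alg_gen X" and c1: "(\<lambda>_. 1) \<in> alg_gen X" by (rule alg_gen.const)+
  let ?P = "\<lambda>c. \<exists>N. \<exists>h\<in>alg_gen X. \<forall>M. y M \<noteq> 0 \<longrightarrow> c (s M) * y M ^ N = h M"
  have P0: "?P c" if "h \<in> alg_gen X" "\<And>M. c (s M) = h M" for c h
    using that by (intro exI[of _ 0] bexI[of _ h]) auto
  have P1: "?P c" if "h \<in> alg_gen X" "\<And>M. c (s M) = h M / y M" for c h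
    using that by (intro exI[of _ 1] bexI[of _ h]) auto
  have P2: "?P c" if "h \<in> alg_gen X" "\<And>M. c (s M) = h M / (y M)\<^sup>2" for c h
    using that by (intro exI[of _ 2] bexI[of _ h]) auto
  have "?P (\<lambda>M. Bm M $ i $ j)" for i j
    using exhaust_2[of j] P0[OF c1, of "\<lambda>M. Bm M $ i $ j"] P0[OF c0, of "\<lambda>M. Bm M $ i $ j"] by (auto simp: s)
  moreover have "?P (\<lambda>M. Bp M $ i $ j)" for i j
    using exhaust_2[of i] P0[OF c1, of "\<lambda>M. Bp M $ i $ j"] P0[OF c0, of "\<lambda>M. Bp M $ i $ j"] by (auto simp: s)
  moreover have "?P (\<lambda>M. A1 M $ i $ j)" for i j
    using exhaust_2[of i] exhaust_2[of j] P0[OF assms(1), of "\<lambda>M. A1 M $ i $ j"]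
      P0[OF c0, of "\<lambda>M. A1 M $ i $ j"] P1[OF assms(3), of "\<lambda>M. A1 M $ i $ j"] by (auto simp: s)
  moreover have "?P (\<lambda>M. A2 M $ i $ j)" for i j
    using exhaust_2[of i] exhaust_2[of j] P0[OF assms(4), of "\<lambda>M. A2 M $ i $ j"]
      P1[OF assms(5), of "\<lambda>M. A2 M $ i $ j"] P1[OF assms(6), of "\<lambda>M. A2 M $ i $ j"]
      P2[OF assms(7), of "\<lambda>M. A2 M $ i $ j"] by (auto simp: s)
  ultimately show "?P c" using c by (auto simp: coord_funs_def)
qed

definition SI_vars :: "var set" where "SI_vars = {X1, X2, X3, X4, X5, X6, X2o}"
definition SI_U_vars :: "var set" where "SI_U_vars = {W1, W2, X1, X3, X4, X5}"

lemma elem_in_alg_gen: "v \<in> V \<Longrightarrow> elem v \<in> alg_gen (elem ` V)"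
  by (intro alg_gen.gen imageI)

lemma SI_localized:
  assumes "f \<in> (SI :: ('k::field_char_0 rep \<Rightarrow> 'k) set)"
  shows "\<exists>N. (\<lambda>M. f M * x1 M ^ N) \<in> alg_gen (elem ` SI_vars)"
proof -
  let ?R = "alg_gen (elem ` SI_vars) :: ('k rep \<Rightarrow> 'k) set"
  have in_R: "x1 \<in> ?R" "x2 \<in> ?R" "x3 \<in> ?R" "x4 \<in> ?R" "x5 \<in> ?R" "polar_det \<in> ?R"
    using elem_in_alg_gen[of X1 SI_vars] elem_in_alg_gen[of X2 SI_vars] elem_in_alg_gen[of X3 SI_vars]
      elem_in_alg_gen[of X4 SI_vars] elem_in_alg_gen[of X5 SI_vars] elem_in_alg_gen[of X2o SI_vars]
    by (simp_all add: SI_vars_def flip: x2o_eq)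
  have f: "f \<in> poly_funs" "\<And>g M. is_SL g \<Longrightarrow> f (base_change g M) = f M"
    using assms by (auto simp: SI_def)
  define s :: "'k rep \<Rightarrow> 'k rep" where "s M = Rep (row2 1 0) (mat2 (x1 M) 0 0 (x5 M / x1 M))
      (mat2 (x2 M) (x4 M / x1 M) (x3 M / x1 M) ((polar_det M * x1 M - x5 M * x2 M) / (x1 M)\<^sup>2)) (col2 1 0)" for M
  have "(\<lambda>M. polar_det M * x1 M - x5 M * x2 M) \<in> ?R" by (intro alg_gen_intros in_R)
  then obtain N h where h: "h \<in> ?R" "\<And>M. x1 M \<noteq> 0 \<Longrightarrow> f (s M) * x1 M ^ N = h M"
    using section_numerator_Rep[OF in_R(1) f(1) in_R(5,2,4,3) _ s_def] by blast
  \<comment> \<open>One more factor \<open>x1\<close> extends the identity to the zeros of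
    \<open>x1\<close>, where both sides vanish.\<close>
  have eq: "f M * x1 M ^ Suc N = h M * x1 M" for M
  proof (cases "x1 M = 0")
    case False
    have "s M = section_rep M"
      using False by (simp add: s_def section_rep_def field_simps power2_eq_square)
    then have "f (s M) = f M" using section_rep_orbit[OF False] f(2) by metis
    then show ?thesis using h(2)[OF False] by simp
  qed simp
  show ?thesis
    using alg_gen.mult[OF h(1) in_R(1)] unfolding eq[symmetric] by (rule exI)
qed

text \<open>Before applying the section, \<open>U\<close> moves \<open>M\<close> to a representation with \<open>x2 = 0\<close>.\<close>

lemma SI_U_localized:
  assumes "f \<in> (SI_U :: ('k::field_char_0 rep \<Rightarrow> 'k) set)"
  shows "\<exists>N. (\<lambda>M. f M * x1 M ^ N) \<in> alg_gen (elem ` SI_U_vars)"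
proof -
  let ?R = "alg_gen (elem ` SI_U_vars) :: ('k rep \<Rightarrow> 'k) set"
  have in_R: "x1 \<in> ?R" "x3 \<in> ?R" "x4 \<in> ?R" "x5 \<in> ?R" "w1 \<in> ?R"
    using elem_in_alg_gen[of X1 SI_U_vars] elem_in_alg_gen[of X3 SI_U_vars]
      elem_in_alg_gen[of X4 SI_U_vars] elem_in_alg_gen[of X5 SI_U_vars] elem_in_alg_gen[of W1 SI_U_vars]
    by (simp_all add: SI_U_vars_def)
  have f: "f \<in> poly_funs" "\<And>g M. is_SL g \<Longrightarrow> f (base_change g M) = f M" "\<And>u M. f (U_act u M) = f M"
    using assms by (auto simp: SI_U_def SI_def)
  define s :: "'k rep \<Rightarrow> 'k rep" where "s M = Rep (row2 1 0) (mat2 (x1 M) 0 0 (x5 M / x1 M))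
      (mat2 ((\<lambda>_. 0) M) (x4 M / x1 M) (x3 M / x1 M) (w1 M / (x1 M)\<^sup>2)) (col2 1 0)" for M
  obtain N h where h: "h \<in> ?R" "\<And>M. x1 M \<noteq> 0 \<Longrightarrow> f (s M) * x1 M ^ N = h M"
    using section_numerator_Rep[OF in_R(1) f(1) in_R(4) alg_gen.const in_R(3,2,5) s_def] by blast
  have eq: "f M * x1 M ^ Suc N = h M * x1 M" for M
  proof (cases "x1 M = 0")
    case False
    \<comment> \<open>This parameter makes \<open>x2\<close> vanish and turns
      \<open>polar_det\<close> into w1 / x1, whence the entry w1 / x1^2 of the section.\<close>
    let ?M = "U_act (- x2 M / x1 M) M"
    have "s M = section_rep ?M"
      using False by (simp add: s_def section_rep_def U_act_x w1_eq x2o_eq field_simps power2_eq_square)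
    moreover have "x1 ?M \<noteq> 0" using False by (simp add: U_act_x)
    ultimately have "f (s M) = f ?M" using section_rep_orbit[of ?M] f(2) by metis
    then show ?thesis using h(2)[OF False] f(3) by simp
  qed simp
  show ?thesis
    using alg_gen.mult[OF h(1) in_R(1)] unfolding eq[symmetric] by (rule exI)
qed

section \<open>Independence of the normal monomials\<close>

text \<open>\<open>section_rep\<close> with the middle arrows exchanged, which changes the signs of
  \<open>x3\<close> and \<open>x4\<close>. Now A2 is diagonal and only \<open>x2\<close> is
  inverted, so points with x1 = 0 are within reach; \<open>x5\<close> is no parameter but follows
  from the relation.\<close>

definition point_rep :: "'k \<Rightarrow> 'k \<Rightarrow> 'k \<Rightarrow> 'k \<Rightarrow> 'k \<Rightarrow> 'k \<Rightarrow> 'k::field rep" where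
  "point_rep y1 y2 y3 y4 y6 y = Rep (row2 1 0)
     (mat2 y1 (- y4 / y2) (- y3 / y2) ((y - y1 * y6 / y2) / y2)) (mat2 y2 0 0 (y6 / y2)) (col2 1 0)"

lemma point_rep_x:
  assumes "y2 \<noteq> 0"
  shows "x1 (point_rep y1 y2 y3 y4 y6 y) = y1" "x2 (point_rep y1 y2 y3 y4 y6 y) = y2"
    "x3 (point_rep y1 y2 y3 y4 y6 y) = y3" "x4 (point_rep y1 y2 y3 y4 y6 y) = y4"
    "x6 (point_rep y1 y2 y3 y4 y6 y) = y6" "polar_det (point_rep y1 y2 y3 y4 y6 y) = y"
    "x5 (point_rep y1 y2 y3 y4 y6 y) = (y1 * (y * y2 - y1 * y6) - y3 * y4) / y2\<^sup>2"
  using assms by (simp_all add: point_rep_def x_eqs field_simps power2_eq_square)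

section \<open>The relations as polynomials and independence on the divisor\<close>

definition SI_lead :: "var \<Rightarrow>\<^sub>0 nat" where "SI_lead = single X3 1 + single X4 1"

definition SI_tail :: "(var, 'k::field_char_0) mpol" where
  "SI_tail = Var X1 * Var X2 * Var X2o - (Var X2)\<^sup>2 * Var X5 - (Var X1)\<^sup>2 * Var X6"

definition SI_U_lead :: "var \<Rightarrow>\<^sub>0 nat" where "SI_U_lead = single W1 2"

definition SI_U_tail :: "(var, 'k::field_char_0) mpol" where
  "SI_U_tail = Var W2 * (Var X1)\<^sup>2 - 4 * Var X3 * Var X4 * Var X5"

lemma SI_rel: "(Var X2)\<^sup>2 * Var X5 + (Var X1)\<^sup>2 * Var X6 + Var X3 * Var X4 - Var X1 * Var X2 * Var X2o
    = single SI_lead 1 - (SI_tail :: (var, 'k::field_char_0) mpol)"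
proof -
  have "single SI_lead 1 = (Var X3 * Var X4 :: (var, 'k) mpol)"
    by (simp add: SI_lead_def Var_def mult_single)
  then show ?thesis by (simp add: SI_tail_def)
qed

lemma SI_U_rel: "(Var W1)\<^sup>2 + 4 * Var X3 * Var X4 * Var X5 - Var W2 * (Var X1)\<^sup>2
    = single SI_U_lead 1 - (SI_U_tail :: (var, 'k::field_char_0) mpol)"
proof -
  have "single SI_U_lead 1 = ((Var W1)\<^sup>2 :: (var, 'k) mpol)"
    by (simp add: SI_U_lead_def Var_def numeral_2_eq_2 mult_single single_add[symmetric])
  then show ?thesis by (simp add: SI_U_tail_def)
qed

lemmas poly_ring_intros = poly_ring_add poly_ring_diff poly_ring_mult poly_ring_power poly_ring_numeral
  poly_ring_Var

lemma SI_tail_poly_ring: "SI_tail \<in> poly_ring (SI_vars - {X3})"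
  unfolding SI_tail_def by (intro poly_ring_intros) (simp_all add: SI_vars_def)

lemma SI_U_tail_poly_ring: "SI_U_tail \<in> poly_ring (SI_U_vars - {W1})"
  unfolding SI_U_tail_def by (intro poly_ring_intros) (simp_all add: SI_U_vars_def)

lemma SI_normal_independent:
  fixes n :: "(var, 'k::field_char_0) mpol"
  assumes n: "keys n \<subseteq> normal_monoms SI_vars SI_lead" "\<And>m. m \<in> keys n \<Longrightarrow> lookup m X1 = 0"
    and zero: "\<And>M. x1 M = 0 \<Longrightarrow> poly_eval (\<lambda>v. elem v M) n = 0"
  shows "n = 0"
proof -
  \<comment> \<open>The exponents after substituting x4 = - x2^2 x5 / x3. A normal monomial does not
    contain both x3 and x4, so the sign of the exponent at \<open>X3\<close> tells which of them
    occurs, and \<open>E\<close> loses nothing. The sign of the substitution moves into the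
    coefficients.\<close>
  define E :: "(var \<Rightarrow>\<^sub>0 nat) \<Rightarrow> var \<Rightarrow> int" where
    "E m v = (case v of X2 \<Rightarrow> int (lookup m X2) + 2 * int (lookup m X4)
      | X3 \<Rightarrow> int (lookup m X3) - int (lookup m X4)
      | X5 \<Rightarrow> int (lookup m X5) + int (lookup m X4) | w \<Rightarrow> int (lookup m w))" for m v
  let ?T = "{X2, X3, X5, X6, X2o}"
  have normal: "lookup m X3 = 0 \<or> lookup m X4 = 0" "keys m \<subseteq> SI_vars" "lookup m X1 = 0" if "m \<in> keys n" for m
  proof -
    have m: "m \<in> normal_monoms SI_vars SI_lead" using that n(1) by blast
    then obtain v where "\<not> lookup SI_lead v \<le> lookup m v" by (auto simp: normal_monoms_def)
    then show "lookup m X3 = 0 \<or> lookup m X4 = 0"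
      by (auto simp: SI_lead_def lookup_add lookup_single when_def split: if_splits)
    show "keys m \<subseteq> SI_vars" using m by (simp add: normal_monoms_def)
  qed (use n(2) that in blast)
  have "\<forall>m\<in>keys n. lookup n m * (- 1) ^ lookup m X4 = 0"
  proof (rule laurent_monomials_independent[where V = ?T and E = E])
    fix m m' assume m: "m \<in> keys n" "m' \<in> keys n" and E: "\<And>v. v \<in> ?T \<Longrightarrow> E m v = E m' v"
    have eq: "lookup m v = lookup m' v" if "v \<in> SI_vars" for v
      using that E[of X2] E[of X3] E[of X5] E[of X6] E[of X2o] normal(1,3)[OF m(1)] normal(1,3)[OF m(2)]
      by (auto simp: SI_vars_def E_def)
    show "m = m'"
    proof (rule poly_mapping_eqI)
      fix v show "lookup m v = lookup m' v"
        using eq[of v] normal(2)[OF m(1)] normal(2)[OF m(2)] by (metis in_keys_iff subsetD)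
    qed
  next
    fix t :: "var \<Rightarrow> 'k" assume t: "\<And>v. t v \<noteq> 0"
    \<comment> \<open>The fourth argument solves x3 x4 = - x2^2 x5, so that \<open>x5\<close> takes
      the value \<open>t X5\<close>.\<close>
    define M where "M = point_rep 0 (t X2) (t X3) (- (t X2)\<^sup>2 * t X5 / t X3) (t X6) (t X2o)"
    have x: "x1 M = 0" "x2 M = t X2" "x3 M = t X3" "x4 M = - (t X2)\<^sup>2 * t X5 / t X3"
      "x5 M = t X5" "x6 M = t X6" "x2o M = t X2o"
      using t by (simp_all add: M_def point_rep_x x2o_eq)
    have "monom_eval (\<lambda>v. elem v M) m = (- 1) ^ lookup m X4 * (\<Prod>v\<in>?T. t v powi E m v)" if "m \<in> keys n" for m
    proof -
      have "monom_eval (\<lambda>v. elem v M) m = (\<Prod>v\<in>SI_vars. elem v M ^ lookup m v)"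
        by (rule monom_eval_superset) (use normal(2)[OF that] in \<open>auto simp: SI_vars_def\<close>)
      also have "\<dots> = t X2 ^ lookup m X2 * t X3 ^ lookup m X3 * (- (t X2)\<^sup>2 * t X5 / t X3) ^ lookup m X4
          * t X5 ^ lookup m X5 * t X6 ^ lookup m X6 * t X2o ^ lookup m X2o"
        using normal(3)[OF that] by (simp add: SI_vars_def x mult_ac)
      also have "(- (t X2)\<^sup>2 * t X5 / t X3) ^ lookup m X4
          = (- 1) ^ lookup m X4 * (t X2 ^ (2 * lookup m X4) * t X5 ^ lookup m X4 / t X3 ^ lookup m X4)"
        by (simp add: power_mult power_mult_distrib power_divide power_minus[of "_ / _"] power_minus[of "_ * _"])
      finally show ?thesis
        using t by (simp add: E_def power_int_add power_int_diff power_int_mult field_simps flip: power_mult)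
    qed
    then have "(\<Sum>m\<in>keys n. lookup n m * (- 1) ^ lookup m X4 * (\<Prod>v\<in>?T. t v powi E m v))
        = poly_eval (\<lambda>v. elem v M) n"
      unfolding poly_eval_eq_sum_keys by (intro sum.cong refl) (simp only: mult.assoc)
    then show "(\<Sum>m\<in>keys n. lookup n m * (- 1) ^ lookup m X4 * (\<Prod>v\<in>?T. t v powi E m v)) = 0"
      using zero[OF x(1)] by simp
  qed simp_all
  then show ?thesis by (intro poly_mapping_eqI) (auto simp: in_keys_iff)
qed

lemma SI_U_normal_independent:
  fixes n :: "(var, 'k::field_char_0) mpol"
  assumes n: "keys n \<subseteq> normal_monoms SI_U_vars SI_U_lead" "\<And>m. m \<in> keys n \<Longrightarrow> lookup m X1 = 0"
    and zero: "\<And>M. x1 M = 0 \<Longrightarrow> poly_eval (\<lambda>v. elem v M) n = 0"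
  shows "n = 0"
proof -
  \<comment> \<open>The exponents after substituting x4 = - w1^2 / (4 x3 x5); the constant - 1 / 4
    moves into the coefficients.\<close>
  define E :: "(var \<Rightarrow>\<^sub>0 nat) \<Rightarrow> var \<Rightarrow> int" where
    "E m v = (case v of W1 \<Rightarrow> int (lookup m W1) + 2 * int (lookup m X4)
      | X3 \<Rightarrow> int (lookup m X3) - int (lookup m X4)
      | X5 \<Rightarrow> int (lookup m X5) - int (lookup m X4) | w \<Rightarrow> int (lookup m w))" for m v
  let ?T = "{W1, W2, X3, X5}"
  have normal: "lookup m W1 < 2" "keys m \<subseteq> SI_U_vars" "lookup m X1 = 0" if "m \<in> keys n" for m
  proof -
    have m: "m \<in> normal_monoms SI_U_vars SI_U_lead" using that n(1) by blast
    then obtain v where "\<not> lookup SI_U_lead v \<le> lookup m v" by (auto simp: normal_monoms_def)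
    then show "lookup m W1 < 2"
      by (auto simp: SI_U_lead_def lookup_single when_def split: if_splits)
    show "keys m \<subseteq> SI_U_vars" using m by (simp add: normal_monoms_def)
  qed (use n(2) that in blast)
  have "\<forall>m\<in>keys n. lookup n m * (- 1 / 4) ^ lookup m X4 = 0"
  proof (rule laurent_monomials_independent[where V = ?T and E = E])
    fix m m' assume m: "m \<in> keys n" "m' \<in> keys n" and E: "\<And>v. v \<in> ?T \<Longrightarrow> E m v = E m' v"
    \<comment> \<open>The exponent of w1 is 0 or 1, so it is the remainder of \<open>E m W1\<close>
      modulo 2, and the exponent of x4 is the quotient.\<close>
    have "lookup m X4 = lookup m' X4 \<and> lookup m W1 = lookup m' W1"
      using E[of W1] normal(1)[OF m(1)] normal(1)[OF m(2)] by (simp add: E_def) presburger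
    then have eq: "lookup m v = lookup m' v" if "v \<in> SI_U_vars" for v
      using that E[of W2] E[of X3] E[of X5] normal(3)[OF m(1)] normal(3)[OF m(2)]
      by (auto simp: SI_U_vars_def E_def)
    show "m = m'"
    proof (rule poly_mapping_eqI)
      fix v show "lookup m v = lookup m' v"
        using eq[of v] normal(2)[OF m(1)] normal(2)[OF m(2)] by (metis in_keys_iff subsetD)
    qed
  next
    fix t :: "var \<Rightarrow> 'k" assume t: "\<And>v. t v \<noteq> 0"
    \<comment> \<open>On x1 = 0 one has w1 = - 2 x2 x5, and with D = 0 also w2 = - 4 x5 x6; the
      arguments solve these for x2 and x6. As x5 is nonzero, D = 0 can always be reached by
      \<open>U\<close>.\<close>
    define M where "M = point_rep 0 (- t W1 / (2 * t X5)) (t X3) (- (t W1)\<^sup>2 / (4 * t X3 * t X5)) (- t W2 / (4 * t X5)) 0"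
    have x: "x1 M = 0" "x3 M = t X3" "x4 M = - (t W1)\<^sup>2 / (4 * t X3 * t X5)" "x5 M = t X5"
      "w1 M = t W1" "w2 M = t W2"
      using t by (simp_all add: M_def point_rep_x x2o_eq w1_eq w2_eq field_simps power2_eq_square)
    have "monom_eval (\<lambda>v. elem v M) m = (- 1 / 4) ^ lookup m X4 * (\<Prod>v\<in>?T. t v powi E m v)" if "m \<in> keys n" for m
    proof -
      have "monom_eval (\<lambda>v. elem v M) m = (\<Prod>v\<in>SI_U_vars. elem v M ^ lookup m v)"
        by (rule monom_eval_superset) (use normal(2)[OF that] in \<open>auto simp: SI_U_vars_def\<close>)
      also have "\<dots> = t W1 ^ lookup m W1 * t W2 ^ lookup m W2 * t X3 ^ lookup m X3
          * (- (t W1)\<^sup>2 / (4 * t X3 * t X5)) ^ lookup m X4 * t X5 ^ lookup m X5"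
        using normal(3)[OF that] by (simp add: SI_U_vars_def x mult_ac)
      also have "- (t W1)\<^sup>2 / (4 * t X3 * t X5) = (- 1 / 4) * ((t W1)\<^sup>2 / (t X3 * t X5))" by simp
      also have "\<dots> ^ lookup m X4
          = (- 1 / 4) ^ lookup m X4 * (t W1 ^ (2 * lookup m X4) / (t X3 ^ lookup m X4 * t X5 ^ lookup m X4))"
        by (simp only: power_mult power_mult_distrib power_divide)
      finally show ?thesis
        using t by (simp add: E_def power_int_add power_int_diff power_int_mult field_simps flip: power_mult)
    qed
    then have "(\<Sum>m\<in>keys n. lookup n m * (- 1 / 4) ^ lookup m X4 * (\<Prod>v\<in>?T. t v powi E m v))
        = poly_eval (\<lambda>v. elem v M) n"
      unfolding poly_eval_eq_sum_keys by (intro sum.cong refl) (simp only: mult.assoc)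
    then show "(\<Sum>m\<in>keys n. lookup n m * (- 1 / 4) ^ lookup m X4 * (\<Prod>v\<in>?T. t v powi E m v)) = 0"
      using zero[OF x(1)] by simp
  qed simp_all
  then show ?thesis by (intro poly_mapping_eqI) (auto simp: in_keys_iff)
qed

section \<open>Generators of the two rings of invariants\<close>

interpretation SI: hypersurface "elem :: var \<Rightarrow> 'k::field_char_0 rep \<Rightarrow> 'k" SI_vars SI_lead SI_tail X1 X3
proof
  show "lookup m X3 = 0" if "m \<in> keys (SI_tail :: (var, 'k) mpol)" for m
    using SI_tail_poly_ring that by (fastforce simp: poly_ring_def in_keys_iff)
  show "SI_tail \<in> poly_ring SI_vars"
    using SI_tail_poly_ring by (auto simp: poly_ring_def)
  show "poly_eval (\<lambda>v. elem v M) (single SI_lead 1 - SI_tail) = 0" for M :: "'k rep"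
    unfolding SI_rel[symmetric] using semi_invariant_relation[of M] by (simp add: x2o_eq algebra_simps)
  show "\<exists>N. elem X1 N \<noteq> (0 :: 'k)" using x12_nonzero by fastforce
  show "keys SI_lead \<subseteq> SI_vars" using keys_add[of "single X3 1" "single X4 (1::nat)"]
    by (auto simp: SI_lead_def SI_vars_def)
  fix n :: "(var, 'k) mpol"
  assume "keys n \<subseteq> normal_monoms SI_vars SI_lead" "\<And>m. m \<in> keys n \<Longrightarrow> lookup m X1 = 0"
    "\<And>M. elem X1 M = 0 \<Longrightarrow> poly_eval (\<lambda>v. elem v M) n = 0"
  then show "n = 0" by (intro SI_normal_independent) simp_all
qed (auto simp: SI_lead_def SI_vars_def lookup_add lookup_single poly_funs_elem)

interpretation SI_U: hypersurface "elem :: var \<Rightarrow> 'k::field_char_0 rep \<Rightarrow> 'k" SI_U_vars SI_U_lead SI_U_tail X1 W1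
proof
  show "lookup m W1 = 0" if "m \<in> keys (SI_U_tail :: (var, 'k) mpol)" for m
    using SI_U_tail_poly_ring that by (fastforce simp: poly_ring_def in_keys_iff)
  show "SI_U_tail \<in> poly_ring SI_U_vars"
    using SI_U_tail_poly_ring by (auto simp: poly_ring_def)
  show "poly_eval (\<lambda>v. elem v M) (single SI_U_lead 1 - SI_U_tail) = 0" for M :: "'k rep"
    unfolding SI_U_rel[symmetric] using U_relation[of M] by simp
  show "\<exists>N. elem X1 N \<noteq> (0 :: 'k)" using x12_nonzero by fastforce
  fix n :: "(var, 'k) mpol"
  assume "keys n \<subseteq> normal_monoms SI_U_vars SI_U_lead" "\<And>m. m \<in> keys n \<Longrightarrow> lookup m X1 = 0"
    "\<And>M. elem X1 M = 0 \<Longrightarrow> poly_eval (\<lambda>v. elem v M) n = 0"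
  then show "n = 0" by (intro SI_U_normal_independent) simp_all
qed (auto simp: SI_U_lead_def SI_U_vars_def lookup_single poly_funs_elem)

lemma SI_eq: "alg_gen (elem ` SI_vars) = (SI :: ('k::field_char_0 rep \<Rightarrow> 'k) set)"
proof
  show "alg_gen (elem ` SI_vars) \<subseteq> (SI :: ('k rep \<Rightarrow> 'k) set)"
    by (rule SI_subalgebra) (use SI_elem in blast)
  show "(SI :: ('k rep \<Rightarrow> 'k) set) \<subseteq> alg_gen (elem ` SI_vars)"
    using SI_localized SI.saturated by (fastforce simp: SI_def)
qed

lemma SI_U_eq: "alg_gen (elem ` SI_U_vars) = (SI_U :: ('k::field_char_0 rep \<Rightarrow> 'k) set)"
proof
  show "alg_gen (elem ` SI_U_vars) \<subseteq> (SI_U :: ('k rep \<Rightarrow> 'k) set)"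
    by (rule SI_U_subalgebra) (use SI_U_elem SI_U_vars_def in blast)
  show "(SI_U :: ('k rep \<Rightarrow> 'k) set) \<subseteq> alg_gen (elem ` SI_U_vars)"
    using SI_U_localized SI_U.saturated by (fastforce simp: SI_U_def SI_def)
qed


section \<open>Minimality and Hilbert series\<close>

lemma not_generating:
  fixes R :: "('k::field rep \<Rightarrow> 'k) set" and M N :: "'k rep"
  assumes "elem v \<in> R" "elem v M \<noteq> elem v N" "\<And>w. w \<in> V - {v} \<Longrightarrow> elem w M = elem w N"
  shows "alg_gen (elem ` (V - {v})) \<noteq> R"
proof
  assume "alg_gen (elem ` (V - {v})) = R"
  then have "elem v \<in> (alg_gen (elem ` (V - {v})) :: ('k rep \<Rightarrow> 'k) set)" using assms(1) by simp
  then have "elem v M = elem v N" by (rule alg_gen_separates) (use assms(3) in blast)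
  then show False using assms(2) by contradiction
qed

lemma SI_minimal:
  assumes "v \<in> SI_vars"
  shows "alg_gen (elem ` (SI_vars - {v})) \<noteq> (SI :: ('k::field_char_0 rep \<Rightarrow> 'k) set)"
proof -
  \<comment> \<open>At \<open>M v\<close> the generator \<open>v\<close> is the only one that does
    not vanish; the last case belongs to \<open>X2o\<close>. At the zero representation all
    generators vanish.\<close>
  define M :: "var \<Rightarrow> 'k rep" where "M v = (case v of
      X1 \<Rightarrow> Rep (row2 1 0) (mat2 1 0 0 0) 0 (col2 1 0)
    | X2 \<Rightarrow> Rep (row2 1 0) 0 (mat2 1 0 0 0) (col2 1 0)
    | X3 \<Rightarrow> Rep 0 (mat2 1 0 0 0) (mat2 0 0 1 0) (col2 1 0)
    | X4 \<Rightarrow> Rep (row2 1 0) (mat2 1 0 0 0) (mat2 0 1 0 0) 0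
    | X5 \<Rightarrow> Rep 0 (mat2 1 0 0 1) 0 0
    | X6 \<Rightarrow> Rep 0 0 (mat2 1 0 0 1) 0
    | _ \<Rightarrow> Rep 0 (mat2 1 0 0 0) (mat2 0 0 0 1) 0)" for v
  show ?thesis
    by (rule not_generating[OF SI_elem, of _ "M v" "Rep 0 0 0 0"])
      (use assms in \<open>auto simp: SI_vars_def M_def x2o_eq x_eqs\<close>)
qed

text \<open>By the relation, \<open>w1\<close> vanishes where all other generators do; two points that differ only
  in its sign separate it from them.\<close>

lemma SI_U_minimal:
  assumes "v \<in> SI_U_vars"
  shows "alg_gen (elem ` (SI_U_vars - {v})) \<noteq> (SI_U :: ('k::field_char_0 rep \<Rightarrow> 'k) set)"
proof -
  define M :: "var \<Rightarrow> 'k rep" where "M v = (case v of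
      X1 \<Rightarrow> Rep (row2 1 0) (mat2 1 0 0 0) 0 (col2 1 0)
    | X3 \<Rightarrow> Rep 0 (mat2 1 0 0 0) (mat2 0 0 1 0) (col2 1 0)
    | X4 \<Rightarrow> Rep (row2 1 0) (mat2 1 0 0 0) (mat2 0 1 0 0) 0
    | X5 \<Rightarrow> Rep 0 (mat2 1 0 0 1) 0 0
    | W1 \<Rightarrow> Rep (row2 1 0) (mat2 1 0 0 0) (mat2 0 0 0 1) (col2 1 0)
    | _ \<Rightarrow> Rep 0 (mat2 1 0 0 0) (mat2 0 0 0 1) 0)" for v
  define N :: "var \<Rightarrow> 'k rep" where "N v = (case v of
      W1 \<Rightarrow> Rep (row2 1 0) (mat2 1 0 0 0) (mat2 0 0 0 (- 1)) (col2 1 0) | _ \<Rightarrow> Rep 0 0 0 0)" for v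
  show ?thesis
    by (rule not_generating[OF SI_U_elem, of _ "M v" "N v"])
      (use assms in \<open>auto simp: SI_U_vars_def M_def N_def x2o_eq w1_eq w2_eq x_eqs\<close>)
qed

text \<open>The height \<lambda>1 + \<lambda>2 is the total degree in the entries of A1 and A2,
  which is positive for every generator.\<close>

interpretation vdeg: positively_graded vdeg "\<lambda>d. fst (snd d) + snd (snd d)"
proof
  fix v show "fst (snd (vdeg v)) + snd (snd (vdeg v)) > 0"
    by (cases v) (simp_all add: d1_def d2_def d3_def d4_def d5_def d6_def d2o_def d2'_def)
qed simp

lemma SI_hilbert_series:
  "has_hilbert_series (SI :: ('k::field_char_0 rep \<Rightarrow> 'k) set)
    ((zpow 0 - zpow (d3 + d4)) \<star> geom d2o \<star> (geom d1 \<star> geom d2 \<star> geom d3 \<star> geom d4 \<star> geom d5 \<star> geom d6))"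
proof -
  let ?V = "{X6, X5, X4, X3, X2, X1}" and ?C = "vdeg.cnt {X6, X5, X4, X3, X2, X1}"
  have C: "geom d1 \<star> geom d2 \<star> geom d3 \<star> geom d4 \<star> geom d5 \<star> geom d6 = ?C"
    using vdeg.geom_eq_cnt[of X1] vdeg.cnt_insert[of "{X1}" X2] vdeg.cnt_insert[of "{X2, X1}" X3]
      vdeg.cnt_insert[of "{X3, X2, X1}" X4] vdeg.cnt_insert[of "{X4, X3, X2, X1}" X5]
      vdeg.cnt_insert[of "{X5, X4, X3, X2, X1}" X6] by simp
  have vars: "SI_vars = insert X2o ?V" by (auto simp: SI_vars_def)
  have fin_normal: "finite {m \<in> normal_monoms SI_vars SI_lead. mweight vdeg m = d}" for d
    by (rule finite_subset[OF _ vdeg.finite_fibre[OF SI.finite_V, of d]]) (auto simp: vdeg.fibre_def normal_monoms_def)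
  have lead: "mweight vdeg SI_lead = d3 + d4" by (simp add: SI_lead_def mweight_add mweight_single)
  \<comment> \<open>The product associates to the left, so the binomial first meets
    \<open>geom d2o\<close>. Regrouping needs this finiteness, which is
    \<open>finite_cnt_geom\<close> reflected by a \<mapsto> d - a.\<close>
  have fin: "finite {a. geom d2o a \<noteq> 0 \<and> ?C (d - a) \<noteq> 0}" for d
  proof -
    have "{a. geom d2o a \<noteq> 0 \<and> ?C (d - a) \<noteq> 0} = (\<lambda>a. d - a) ` {a. ?C a \<noteq> 0 \<and> geom d2o (d - a) \<noteq> 0}"
      by (force simp: image_iff intro: exI[of _ "d - _"])
    then show ?thesis using vdeg.finite_cnt_geom[of ?V X2o d] by simp
  qed
  have "zpow 0 - zpow (d3 + d4) = (\<lambda>d. zpow 0 d + (- 1) * zpow (d3 + d4) d)" by (simp add: fun_eq_iff)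
  moreover have "d3 + d4 \<noteq> 0" by (simp add: d3_def d4_def zero_prod_def)
  moreover have "geom d2o \<star> ?C = vdeg.cnt SI_vars"
    using vdeg.cnt_insert[of ?V X2o] by (simp add: series_mult_commute[of "geom d2o"] vars)
  ultimately have "(zpow 0 - zpow (d3 + d4)) \<star> geom d2o \<star> ?C
      = (\<lambda>d. vdeg.cnt SI_vars d - vdeg.cnt SI_vars (d - (d3 + d4)))"
    using binomial_mult_assoc[OF _ fin, of "d3 + d4" "- 1"] by simp
  moreover have "int (card {m \<in> normal_monoms SI_vars SI_lead. mweight vdeg m = d})
      = vdeg.cnt SI_vars d - vdeg.cnt SI_vars (d - (d3 + d4))" for d
    unfolding lead[symmetric] by (rule vdeg.cnt_normal_monoms[OF SI.finite_V SI.L_V]) (use SI.L_v0 in force)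
  moreover have "(\<exists>B. finite B \<and> component (SI :: ('k rep \<Rightarrow> 'k) set) d \<subseteq> module.span scale_fun B) \<and>
      vector_space.dim scale_fun (component (SI :: ('k rep \<Rightarrow> 'k) set) d)
        = card {m \<in> normal_monoms SI_vars SI_lead. mweight vdeg m = d}" for d
    unfolding SI_eq[symmetric] by (rule SI.component_dim[OF has_weight_elem fin_normal])
  ultimately show ?thesis
    unfolding has_hilbert_series_def C by (intro allI) simp
qed

lemma SI_U_hilbert_series:
  "has_hilbert_series (SI_U :: ('k::field_char_0 rep \<Rightarrow> 'k) set)
    ((zpow 0 + zpow d2') \<star> (geom d1 \<star> geom d3 \<star> geom d4 \<star> geom d5 \<star> geom (d2o + d2o)))"
proof -
  let ?V = "{W2, X5, X4, X3, X1}"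
  have C: "geom d1 \<star> geom d3 \<star> geom d4 \<star> geom d5 \<star> geom (d2o + d2o) = vdeg.cnt ?V"
    using vdeg.geom_eq_cnt[of X1] vdeg.cnt_insert[of "{X1}" X3] vdeg.cnt_insert[of "{X3, X1}" X4]
      vdeg.cnt_insert[of "{X4, X3, X1}" X5] vdeg.cnt_insert[of "{X5, X4, X3, X1}" W2] by simp
  have vars: "SI_U_vars = insert W1 ?V" by (auto simp: SI_U_vars_def)
  have fin_normal: "finite {m \<in> normal_monoms SI_U_vars SI_U_lead. mweight vdeg m = d}" for d
    by (rule finite_subset[OF _ vdeg.finite_fibre[OF SI_U.finite_V, of d]]) (auto simp: vdeg.fibre_def normal_monoms_def)
  have "zpow 0 + zpow d2' = (\<lambda>d. zpow 0 d + 1 * zpow d2' d)" by (simp add: fun_eq_iff)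
  moreover have "d2' \<noteq> 0" using vdeg.deg_nonzero[of W1] by simp
  ultimately have "(zpow 0 + zpow d2') \<star> vdeg.cnt ?V = (\<lambda>d. vdeg.cnt ?V d + vdeg.cnt ?V (d - d2'))"
    using binomial_mult[of d2' 1 "vdeg.cnt ?V"] by simp
  moreover have "int (card {m \<in> normal_monoms SI_U_vars SI_U_lead. mweight vdeg m = d})
      = vdeg.cnt ?V d + vdeg.cnt ?V (d - d2')" for d
    using vdeg.cnt_normal_monoms_square[of ?V W1 d] by (simp add: vars SI_U_lead_def)
  moreover have "(\<exists>B. finite B \<and> component (SI_U :: ('k rep \<Rightarrow> 'k) set) d \<subseteq> module.span scale_fun B) \<and>
      vector_space.dim scale_fun (component (SI_U :: ('k rep \<Rightarrow> 'k) set) d)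
        = card {m \<in> normal_monoms SI_U_vars SI_U_lead. mweight vdeg m = d}" for d
    unfolding SI_U_eq[symmetric] by (rule SI_U.component_dim[OF has_weight_elem fin_normal])
  ultimately show ?thesis
    unfolding has_hilbert_series_def C by (intro allI) simp
qed

theorem proposition9p3:
  shows
    "(minimally_presented (SI :: ('k::{alg_closed_field, field_char_0} rep \<Rightarrow> 'k) set)
       {X1, X2, X3, X4, X5, X6, X2o}
       ((Var X2)\<^sup>2 * Var X5 + (Var X1)\<^sup>2 * Var X6 + Var X3 * Var X4 - Var X1 * Var X2 * Var X2o) \<and>
      has_hilbert_series (SI :: ('k rep \<Rightarrow> 'k) set)
       ((zpow 0 - zpow (d3 + d4)) \<star> geom d2o \<star>
        (geom d1 \<star> geom d2 \<star> geom d3 \<star> geom d4 \<star> geom d5 \<star> geom d6))) \<and>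
     (minimally_presented (SI_U :: ('k rep \<Rightarrow> 'k) set)
       {W1, W2, X1, X3, X4, X5}
       ((Var W1)\<^sup>2 + 4 * Var X3 * Var X4 * Var X5 - Var W2 * (Var X1)\<^sup>2) \<and>
      has_hilbert_series (SI_U :: ('k rep \<Rightarrow> 'k) set)
       ((zpow 0 + zpow d2') \<star>
        (geom d1 \<star> geom d3 \<star> geom d4 \<star> geom d5 \<star> geom (d2o + d2o))))"
proof (intro conjI SI_hilbert_series SI_U_hilbert_series)
  show "minimally_presented (SI :: ('k rep \<Rightarrow> 'k) set) {X1, X2, X3, X4, X5, X6, X2o}
      ((Var X2)\<^sup>2 * Var X5 + (Var X1)\<^sup>2 * Var X6 + Var X3 * Var X4 - Var X1 * Var X2 * Var X2o)"
    unfolding minimally_presented_def SI_rel SI_vars_def[symmetric]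
    using SI_minimal SI_elem has_weight_elem by (auto simp: SI_eq SI.relations_eq component_def)
  show "minimally_presented (SI_U :: ('k rep \<Rightarrow> 'k) set) {W1, W2, X1, X3, X4, X5}
      ((Var W1)\<^sup>2 + 4 * Var X3 * Var X4 * Var X5 - Var W2 * (Var X1)\<^sup>2)"
    unfolding minimally_presented_def SI_U_rel SI_U_vars_def[symmetric]
    using SI_U_minimal SI_U_elem[folded SI_U_vars_def] has_weight_elem
    by (auto simp: SI_U_eq SI_U.relations_eq component_def)
qed

end
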